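(* For every $\alpha\in(0,\frac{2\pi}{3}]$ and every integer $n\geq 2$, we have $M_b^\|(n,\alpha)\leq 4n-6$; that is, every $\alpha$-bend multigraph on $n$ vertices has at most $4n-6$ edges.
   Context: For $\alpha\in(0,\pi)$, an $\alpha$-bend edge between points $a$ and $c$ is a polyline $(a,b,c)$ with a single bend point $b$ (not on the line $ac$) such that the interior angle of the triangle $abc$ at $b$ equals $\alpha$. An $\alpha$-bend multigraph is a multigraph embedded in the plane (vertices are distinct points; edges pairwise do not cross, meet only at common endpoints, and contain no vertex in their relative interior; parallel edges allowed) in which every edge is an $\alpha$-bend edge. $M_b^\|(n,\alpha)$ is the supremum, over all $n$-element sets $P\subset\mathbb{R}^2$, of the maximum number of edges of an $\alpha$-bend multigraph with vertex set $P$. *)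

theory Defs
  imports "HOL-Analysis.Analysis"
begin

type_synonym point = "real ^ 2"

definition vangle :: "point \<Rightarrow> point \<Rightarrow> point \<Rightarrow> real" where
  "vangle a b c = arccos (((a - b) \<bullet> (c - b)) / (norm (a - b) * norm (c - b)))"

text \<open>An edge is a triple (a, b, c): endpoints a, c and bend point b.\<close>
type_synonym bend_edge = "point \<times> point \<times> point"

definition endpoints :: "bend_edge \<Rightarrow> point set" where
  "endpoints e = (case e of (a, b, c) \<Rightarrow> {a, c})"

definition polyline :: "bend_edge \<Rightarrow> point set" where
  "polyline e = (case e of (a, b, c) \<Rightarrow> closed_segment a b \<union> closed_segment b c)"

definition alpha_bend_edge :: "real \<Rightarrow> bend_edge \<Rightarrow> bool" where
  "alpha_bend_edge \<alpha> e = (case e of (a, b, c) \<Rightarrow>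
     a \<noteq> c \<and> b \<notin> affine hull {a, c} \<and> vangle a b c = \<alpha>)"

definition alpha_bend_multigraph :: "real \<Rightarrow> point set \<Rightarrow> bend_edge list \<Rightarrow> bool" where
  "alpha_bend_multigraph \<alpha> P es \<longleftrightarrow>
     finite P \<and>
     (\<forall>e \<in> set es. alpha_bend_edge \<alpha> e \<and> endpoints e \<subseteq> P \<and>
        (\<forall>p \<in> P. p \<in> polyline e \<longrightarrow> p \<in> endpoints e)) \<and>
     (\<forall>i < length es. \<forall>j < length es. i \<noteq> j \<longrightarrow>
        polyline (es ! i) \<inter> polyline (es ! j) \<subseteq> endpoints (es ! i) \<inter> endpoints (es ! j))"

end

theory Submission
  imports Defs
begin

text \<open>
  Join the \<open>n\<close> vertices and the \<open>m\<close> bends by the \<open>2 * m\<close> straight pieces of the edges, and rotate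
  so that no two of the \<open>n + m\<close> points share an abscissa. Each face sees \<open>x\<close> bends from their
  convex side (angle \<open>\<alpha>\<close>) and \<open>y\<close> bends from their reflex side (angle \<open>2 * pi - \<alpha>\<close>).
  Let \<open>D\<close> be the number of segments bounding the face from below minus the number of points
  directly above which the face lies. A sweep shows that the angles of the face sum to
  \<open>2 * pi * (x + y - D)\<close>. Moreover \<open>D \<le> 1\<close>: the face is a connected component of the graph whose nodes
  are the segments and whose edges are the points, a point joining the two segments just below it on
  its left and on its right; and \<open>D \<le> -1\<close> for the outer face, whose component contains a cycle and
  also the extra node at minus infinity.

  The angles at the true vertices are positive, so \<open>(2 * pi - \<alpha>) * x + \<alpha> * y > 2 * pi * D\<close>, and for
  \<open>\<alpha> \<le> 2 * pi / 3\<close> integrality upgrades this to \<open>2 * x + y \<ge> 4 * D\<close>; for the outer face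
  \<open>2 * x + y - 4 * D \<ge> 6\<close>. Summing over all faces, \<open>3 * m - 4 * (2 * m - (n + m)) \<ge> 6\<close>.
\<close>

section \<open>Connected components of a finite multigraph\<close>

text \<open>Edges are inserted one at a time. An edge between two classes merges them: their two
  surplus nodes become one surplus node plus the new edge, so every class keeps at most one node
  more than it has edges, as in a spanning tree.\<close>

lemma component_labelling:
  fixes p q :: "'e \<Rightarrow> 'n"
  assumes "finite E" "finite M" "\<And>e. e \<in> E \<Longrightarrow> p e \<in> M" "\<And>e. e \<in> E \<Longrightarrow> q e \<in> M"
  shows "\<exists>F :: 'n \<Rightarrow> 'n. (\<forall>e\<in>E. F (p e) = F (q e)) \<and>
    (\<forall>f. card {n \<in> M. F n = f} \<le> card {e \<in> E. F (p e) = f} + 1)"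
  using assms
proof (induction E rule: finite_induct)
  case empty
  have "card {n \<in> M. n = f} \<le> 1" for f
    by (rule order_trans[OF card_mono[of "{f}"]]) auto
  then show ?case by (intro exI[of _ "\<lambda>n. n"]) auto
next
  case (insert e E)
  then obtain F :: "'n \<Rightarrow> 'n" where F: "\<And>e. e \<in> E \<Longrightarrow> F (p e) = F (q e)"
    and cnt: "\<And>f. card {n \<in> M. F n = f} \<le> card {e \<in> E. F (p e) = f} + 1" by auto
  define a b where "a = F (p e)" and "b = F (q e)"
  define G where "G n = (if F n = b then a else F n)" for n
  have "G (p e') = G (q e')" if "e' \<in> insert e E" for e'
    using that F by (auto simp: G_def a_def b_def)
  moreover have "card {n \<in> M. G n = f} \<le> card {e' \<in> insert e E. G (p e') = f} + 1" for f
  proof -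
    consider "a = b" | "a \<noteq> b" "f = a" | "a \<noteq> b" "f = b" | "f \<noteq> a" "f \<noteq> b" by blast
    then show ?thesis
    proof cases
      case 1
      then have "G = F" by (auto simp: G_def)
      have "card {e' \<in> E. F (p e') = f} \<le> card {e' \<in> insert e E. F (p e') = f}"
        using insert.hyps by (intro card_mono) auto
      then show ?thesis unfolding \<open>G = F\<close> using cnt[of f] by linarith
    next
      case 2
      have "{n \<in> M. G n = f} = {n \<in> M. F n = a} \<union> {n \<in> M. F n = b}"
        using 2 by (auto simp: G_def)
      then have 1: "card {n \<in> M. G n = f} \<le> card {n \<in> M. F n = a} + card {n \<in> M. F n = b}"
        by (simp add: card_Un_le)
      have "{e' \<in> insert e E. G (p e') = f} =
          insert e ({e' \<in> E. F (p e') = a} \<union> {e' \<in> E. F (p e') = b})"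
        using 2 by (auto simp: G_def a_def)
      moreover have "card \<dots> = Suc (card {e' \<in> E. F (p e') = a} + card {e' \<in> E. F (p e') = b})"
        using insert.hyps 2 by (subst card_insert_disjoint) (auto intro!: card_Un_disjoint)
      ultimately show ?thesis using 1 cnt[of a] cnt[of b] by simp
    next
      case 3
      then have "{n \<in> M. G n = f} = {}" by (auto simp: G_def)
      then show ?thesis by (metis card.empty le0)
    next
      case 4
      then have "{n \<in> M. G n = f} = {n \<in> M. F n = f}" by (auto simp: G_def)
      moreover have "{e' \<in> insert e E. G (p e') = f} = {e' \<in> E. F (p e') = f}"
        using 4 by (auto simp: G_def a_def)
      ultimately show ?thesis using cnt[of f] by simp
    qed
  qed
  ultimately show ?case by blast
qed

subsection \<open>Faces of a planar straight-line drawing\<close>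

definition slope :: "(nat \<Rightarrow> real) \<Rightarrow> (nat \<Rightarrow> real) \<Rightarrow> nat \<Rightarrow> nat \<Rightarrow> real" where
  "slope X Y i j = (Y j - Y i) / (X j - X i)"

definition height :: "(nat \<Rightarrow> real) \<Rightarrow> (nat \<Rightarrow> real) \<Rightarrow> nat \<Rightarrow> nat \<Rightarrow> real \<Rightarrow> real" where
  "height X Y i j x = Y i + slope X Y i j * (x - X i)"

text \<open>Numbering the points by abscissa lets indices stand for positions. Although
  \<open>meet\<close> names only the ends of \<open>s\<close>, exchanging \<open>s\<close> and
  \<open>t\<close> makes a common point an end of both.\<close>

locale sweep =
  fixes N :: nat and X Y :: "nat \<Rightarrow> real" and S :: "'s set" and lft rgt :: "'s \<Rightarrow> nat"
  assumes X_less: "\<And>i j. i < j \<Longrightarrow> j < N \<Longrightarrow> X i < X j"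
    and finite_S: "finite S"
    and S_less: "\<And>s. s \<in> S \<Longrightarrow> lft s < rgt s \<and> rgt s < N"
    and meet: "\<And>s t x. s \<in> S \<Longrightarrow> t \<in> S \<Longrightarrow> s \<noteq> t \<Longrightarrow>
      X (lft s) \<le> x \<Longrightarrow> x \<le> X (rgt s) \<Longrightarrow> X (lft t) \<le> x \<Longrightarrow> x \<le> X (rgt t) \<Longrightarrow>
      height X Y (lft s) (rgt s) x = height X Y (lft t) (rgt t) x \<Longrightarrow>
      x = X (lft s) \<or> x = X (rgt s)"
    and no_inner: "\<And>s v. s \<in> S \<Longrightarrow> lft s < v \<Longrightarrow> v < rgt s \<Longrightarrow>
      height X Y (lft s) (rgt s) (X v) \<noteq> Y v"
begin

abbreviation sl where "sl s \<equiv> slope X Y (lft s) (rgt s)"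
abbreviation ht where "ht s \<equiv> height X Y (lft s) (rgt s)"

lemma X_le: "i \<le> j \<Longrightarrow> j < N \<Longrightarrow> X i \<le> X j"
  using X_less[of i j] by (cases "i = j") auto

lemma X_inj: "i < N \<Longrightarrow> j < N \<Longrightarrow> X i = X j \<Longrightarrow> i = j"
  using X_less[of i j] X_less[of j i] by (cases i j rule: linorder_cases) auto

lemma ht_lft [simp]: "ht s (X (lft s)) = Y (lft s)"
  by (simp add: height_def)

lemma ht_rgt: "s \<in> S \<Longrightarrow> ht s (X (rgt s)) = Y (rgt s)"
  using X_less[of "lft s" "rgt s"] S_less[of s] by (simp add: height_def slope_def)

lemma ht_diff: "ht s x - ht s y = sl s * (x - y)"
  by (simp add: height_def algebra_simps)

text \<open>The slab \<open>k\<close> lies between the vertices \<open>k - 1\<close> and \<open>k\<close>; the slabs \<open>0\<close> and \<open>N\<close> are unbounded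
  and meet no segment.\<close>

definition active :: "nat \<Rightarrow> 's set" where
  "active k = {s \<in> S. lft s < k \<and> k \<le> rgt s}"

text \<open>Active segments do not cross inside a slab, so a single abscissa per slab is enough to
  order them.\<close>

definition mid :: "nat \<Rightarrow> real" where
  "mid k = (X (k - 1) + X k) / 2"

lemma activeD: "s \<in> active k \<Longrightarrow> s \<in> S \<and> lft s < k \<and> k \<le> rgt s \<and> k < N \<and> 0 < k"
  using S_less[of s] by (auto simp: active_def)

lemma finite_active: "finite (active k)"
  using finite_S by (auto simp: active_def)

lemma active_0 [simp]: "active 0 = {}" and active_N [simp]: "active N = {}"
  using activeD by blast+

lemma mid_bounds: "0 < k \<Longrightarrow> k < N \<Longrightarrow> X (k - 1) < mid k \<and> mid k < X k"
  using X_less[of "k - 1" k] by (auto simp: mid_def)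

lemma active_neq:
  assumes "s \<in> active k" "t \<in> active k" "s \<noteq> t" "X (k - 1) < z" "z < X k"
  shows "ht s z \<noteq> ht t z"
proof
  assume eq: "ht s z = ht t z"
  have b: "X (lft u) < z \<and> z < X (rgt u)" if "u \<in> active k" for u
  proof -
    have "X (lft u) \<le> X (k - 1)" "X k \<le> X (rgt u)"
      using activeD[OF that] S_less[of u] by (auto intro: X_le)
    then show ?thesis using assms by linarith
  qed
  show False using meet[of s t z] b[of s] b[of t] assms activeD[of s k] activeD[of t k] eq by force
qed

text \<open>Intermediate value theorem, to the right or to the left of \<open>x\<close>. Strictness
  at \<open>x\<close> keeps the crossing away from \<open>x\<close>, which may be a border of a
  slab.\<close>

lemma sign_change:
  fixes x y :: real
  assumes "ht s x < ht t x" "ht t y \<le> ht s y"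
  shows "\<exists>z. ht s z = ht t z \<and> (x < z \<and> z \<le> y \<or> y \<le> z \<and> z < x)"
proof -
  have c: "continuous_on A (\<lambda>z. ht s z - ht t z)" for A
    unfolding height_def by (intro continuous_intros)
  show ?thesis
  proof (cases "x \<le> y")
    case True
    then obtain z where "x \<le> z" "z \<le> y" "ht s z - ht t z = 0"
      using IVT'[of "\<lambda>z. ht s z - ht t z" x 0 y] assms c by auto
    then show ?thesis using assms by (intro exI[of _ z]) (cases "z = x"; auto)
  next
    case False
    then obtain z where "y \<le> z" "z \<le> x" "ht s z - ht t z = 0"
      using IVT2'[of "\<lambda>z. ht s z - ht t z" x 0 y] assms c by auto
    then show ?thesis using assms by (intro exI[of _ z]) (cases "z = x"; auto)
  qed
qed

lemma mid_neq: "s \<in> active k \<Longrightarrow> t \<in> active k \<Longrightarrow> s \<noteq> t \<Longrightarrow> ht s (mid k) \<noteq> ht t (mid k)"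
  using active_neq mid_bounds activeD by blast

text \<open>A different order at the midpoint would force a crossing strictly inside the
  slab.\<close>

lemma mid_less_right:
  assumes "s \<in> active k" "t \<in> active k" "ht s (X k) < ht t (X k)"
  shows "ht s (mid k) < ht t (mid k)"
proof (rule ccontr)
  assume "\<not> ?thesis"
  then obtain z where z: "ht s z = ht t z" "X k < z \<and> z \<le> mid k \<or> mid k \<le> z \<and> z < X k"
    using sign_change[OF assms(3), of "mid k"] by auto
  have "X (k - 1) < mid k" "mid k < X k" using mid_bounds activeD[OF assms(1)] by auto
  with z active_neq[OF assms(1,2), of z] assms(3) show False by force
qed

lemma mid_less_left:
  assumes "s \<in> active k" "t \<in> active k" "ht s (X (k - 1)) < ht t (X (k - 1))"
  shows "ht s (mid k) < ht t (mid k)"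
proof (rule ccontr)
  assume "\<not> ?thesis"
  then obtain z where z: "ht s z = ht t z"
      "X (k - 1) < z \<and> z \<le> mid k \<or> mid k \<le> z \<and> z < X (k - 1)"
    using sign_change[OF assms(3), of "mid k"] by auto
  have "X (k - 1) < mid k" "mid k < X k" using mid_bounds activeD[OF assms(1)] by auto
  with z active_neq[OF assms(1,2), of z] assms(3) show False by force
qed

lemma active_ends:
  assumes "s \<in> active k" "ht s (X k) = Y k" shows "rgt s = k"
  using no_inner[of s k] activeD[OF assms(1)] assms(2) by (cases "k < rgt s") auto

lemma active_starts:
  assumes "s \<in> active (Suc k)" "ht s (X k) = Y k" shows "lft s = k"
  using no_inner[of s k] activeD[OF assms(1)] assms(2) by (cases "lft s < k") auto

text \<open>Vertex \<open>k\<close> alone separates the two slabs, so only segments ending or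
  starting there can be active in just one of them.\<close>

lemma active_Suc_iff:
  assumes "ht s (X k) \<noteq> Y k"
  shows "s \<in> active k \<longleftrightarrow> s \<in> active (Suc k)"
proof -
  have "rgt s \<noteq> k" if "s \<in> active k"
    using ht_rgt[of s] activeD[OF that] assms by auto
  moreover have "lft s \<noteq> k" if "s \<in> active (Suc k)" using assms by auto
  ultimately show ?thesis by (auto simp: active_def)
qed

text \<open>By \<open>meet\<close> the common point is an end of \<open>s\<close>, and since
  \<open>s\<close> reaches into the slab on the left it is the right end.\<close>

lemma meet_at_vertex:
  assumes "s \<in> active k" "t \<in> active k" "s \<noteq> t" "ht s (X k) = ht t (X k)"
  shows "ht s (X k) = Y k"
proof -
  have *: "X (lft u) < X k \<and> X k \<le> X (rgt u) \<and> rgt u < N \<and> u \<in> S" if "u \<in> active k" for u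
    using activeD[OF that] S_less[of u] X_less[of "lft u" k] X_le[of k "rgt u"] by auto
  have "X k = X (rgt s)"
    using meet[of s t "X k"] assms *[OF assms(1)] *[OF assms(2)] by force
  then have "rgt s = k" using *[OF assms(1)] X_inj[of k "rgt s"] activeD[OF assms(1)] by auto
  then show ?thesis using ht_rgt[of s] *[OF assms(1)] by auto
qed

text \<open>\<open>None\<close> stands for the unbounded cell below all segments.\<close>

definition topmost :: "nat \<Rightarrow> 's set \<Rightarrow> 's option" where
  "topmost k A = (if A = {} then None else Some (arg_min_on (\<lambda>s. - ht s (mid k)) A))"

lemma top_empty [simp]: "topmost k {} = None" by (simp add: topmost_def)

lemma top_eqI:
  assumes "A \<subseteq> active k" "s \<in> A" "\<And>t. t \<in> A \<Longrightarrow> t \<noteq> s \<Longrightarrow> ht t (mid k) < ht s (mid k)"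
  shows "topmost k A = Some s"
proof -
  have f: "finite A" using assms(1) finite_active finite_subset by blast
  let ?m = "arg_min_on (\<lambda>s. - ht s (mid k)) A"
  have "A \<noteq> {}" using assms(2) by auto
  note m = arg_min_if_finite[OF f this, of "\<lambda>s. - ht s (mid k)"]
  have "?m = s"
  proof (rule ccontr)
    assume "?m \<noteq> s"
    then have "ht ?m (mid k) < ht s (mid k)" using assms(3) m(1) by simp
    then show False using m(2) assms(2) by auto
  qed
  then show ?thesis using assms(2) by (auto simp: topmost_def)
qed

lemma top_mem:
  assumes "A \<subseteq> active k" shows "topmost k A \<in> insert None (Some ` A)"
proof (cases "A = {}")
  case False
  have "finite A" using assms finite_active finite_subset by blast
  then have "arg_min_on (\<lambda>s. - ht s (mid k)) A \<in> A" using False by (rule arg_min_if_finite(1))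
  then show ?thesis unfolding topmost_def using False by simp
qed simp

text \<open>A cell of a slab is named by the segment bounding it from below. Thus
  \<open>bl v\<close> and \<open>br v\<close> are the cells directly above vertex \<open>v\<close>
  on its left and right; they meet along the vertical above \<open>v\<close> and belong to one face.
  The non-strict comparison admits the segments through \<open>v\<close> itself.\<close>

definition bl :: "nat \<Rightarrow> 's option" where
  "bl v = topmost v {t \<in> active v. ht t (X v) \<le> Y v}"

definition br :: "nat \<Rightarrow> 's option" where
  "br v = topmost (Suc v) {t \<in> active (Suc v). ht t (X v) \<le> Y v}"

text \<open>The cell directly under \<open>s\<close>, again named by its lower segment.\<close>

definition below :: "nat \<Rightarrow> 's \<Rightarrow> 's option" where
  "below k s = topmost k {t \<in> active k. ht t (mid k) < ht s (mid k)}"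

section \<open>Following a face past a vertex\<close>

lemma top_both:
  assumes "A \<subseteq> active v" "B \<subseteq> active (Suc v)" "u \<in> A" "u \<in> B"
    and "\<And>t. t \<in> A \<union> B \<Longrightarrow> t \<noteq> u \<Longrightarrow> ht t (X v) < ht u (X v)"
  shows "topmost v A = Some u \<and> topmost (Suc v) B = Some u"
proof
  show "topmost v A = Some u"
    using assms by (intro top_eqI mid_less_right) auto
  show "topmost (Suc v) B = Some u"
    using assms by (intro top_eqI mid_less_left) auto
qed

lemma max_at_vertex:
  assumes "U \<noteq> {}" "U \<subseteq> active v" "\<And>t. t \<in> U \<Longrightarrow> ht t (X v) \<noteq> Y v"
  shows "\<exists>u\<in>U. \<forall>t\<in>U. t \<noteq> u \<longrightarrow> ht t (X v) < ht u (X v)"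
proof -
  have f: "finite U" using assms(2) finite_active finite_subset by blast
  let ?m = "arg_min_on (\<lambda>s. - ht s (X v)) U"
  note m = arg_min_if_finite[OF f assms(1), of "\<lambda>s. - ht s (X v)"]
  have "ht t (X v) \<noteq> ht ?m (X v)" if "t \<in> U" "t \<noteq> ?m" for t
    using meet_at_vertex[of t v ?m] that m(1) assms by auto
  then show ?thesis using m by (intro bexI[of _ ?m]) force+
qed

text \<open>If the highest segment misses vertex \<open>v\<close>, it continues through both slabs
  and names both cells. Otherwise the two cells are those directly above \<open>v\<close>, which
  \<open>F\<close> identifies. The hypothesis \<open>cases\<close> forbids sets that contain only
  some of the segments through \<open>v\<close>.\<close>

lemma top_step:
  assumes A: "A \<subseteq> active v" and B: "B \<subseteq> active (Suc v)"
    and AB: "\<And>t. ht t (X v) \<noteq> Y v \<Longrightarrow> t \<in> A \<longleftrightarrow> t \<in> B"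
    and cases: "(\<forall>t\<in>A \<union> B. ht t (X v) < Y v) \<or>
      {t \<in> active v. ht t (X v) \<le> Y v} \<subseteq> A \<and> {t \<in> active (Suc v). ht t (X v) \<le> Y v} \<subseteq> B"
    and F: "F (bl v) = F (br v)"
  shows "F (topmost v A) = F (topmost (Suc v) B)"
proof -
  consider (hi) "\<exists>t\<in>A \<union> B. ht t (X v) > Y v" | (lo) "\<forall>t\<in>A \<union> B. ht t (X v) < Y v"
    | (eq) "\<forall>t\<in>A \<union> B. ht t (X v) \<le> Y v"
      "{t \<in> active v. ht t (X v) \<le> Y v} \<subseteq> A \<and> {t \<in> active (Suc v). ht t (X v) \<le> Y v} \<subseteq> B"
    using cases not_less by blast
  then show ?thesis
  proof cases
    case hi
    define U where "U = {t \<in> A. ht t (X v) > Y v}"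
    have "U \<noteq> {}" using hi AB by (force simp: U_def)
    then obtain u where u: "u \<in> U" "\<And>t. t \<in> U \<Longrightarrow> t \<noteq> u \<Longrightarrow> ht t (X v) < ht u (X v)"
      using max_at_vertex[of U v] A by (auto simp: U_def)
    have "ht t (X v) < ht u (X v)" if "t \<in> A \<union> B" "t \<noteq> u" for t
      using that u AB[of t] by (cases "ht t (X v) > Y v") (auto simp: U_def)
    moreover have "u \<in> A" "u \<in> B" using u AB[of u] by (auto simp: U_def)
    ultimately show ?thesis using top_both[OF A B] by simp
  next
    case lo
    then have "A = B" using AB by force
    show ?thesis
    proof (cases "A = {}")
      case False
      then obtain u where "u \<in> A" "\<And>t. t \<in> A \<Longrightarrow> t \<noteq> u \<Longrightarrow> ht t (X v) < ht u (X v)"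
        using max_at_vertex[of A v] A lo by force
      then show ?thesis using top_both[OF A B] \<open>A = B\<close> by force
    qed (use \<open>A = B\<close> in simp)
  next
    case eq
    then have "A = {t \<in> active v. ht t (X v) \<le> Y v}"
      "B = {t \<in> active (Suc v). ht t (X v) \<le> Y v}" using A B by blast+
    then show ?thesis using F by (simp add: bl_def br_def)
  qed
qed

lemma top_active_step:
  assumes "F (bl v) = F (br v)"
  shows "F (topmost v (active v)) = F (topmost (Suc v) (active (Suc v)))"
  using assms active_Suc_iff by (intro top_step) auto

text \<open>The labels are the components of the graph in which vertex \<open>v\<close> joins
  \<open>bl v\<close> to \<open>br v\<close>. The last bound gains two units over the general one:
  the node \<open>None\<close> is no segment, and the edge of vertex 0 closes a cycle.\<close>

lemma exists_labelling:
  assumes "0 < N"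
  shows "\<exists>F :: 's option \<Rightarrow> 's option.
    (\<forall>v<N. F (bl v) = F (br v)) \<and>
    (\<forall>f. card {s \<in> S. F (Some s) = f} \<le> card {v. v < N \<and> F (bl v) = f} + 1) \<and>
    card {s \<in> S. F (Some s) = F None} + 1 \<le> card {v. v < N \<and> F (bl v) = F None}"
proof -
  let ?M = "insert None (Some ` S)"
  have sub: "active k \<subseteq> S" for k by (auto simp: active_def)
  have tM: "topmost k A \<in> ?M" if "A \<subseteq> active k" for k A
    using top_mem[OF that] that sub by blast
  have bl: "bl v \<in> ?M" and br: "br v \<in> ?M" for v :: nat
    unfolding bl_def br_def by (rule tM; auto)+
  have "finite ?M" using finite_S by simp
  \<comment> \<open>Vertex 0 is withheld here; its edge will turn out to join nodes that already
    share a label.\<close>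
  then have "\<exists>F :: 's option \<Rightarrow> 's option. (\<forall>v\<in>{1..<N}. F (bl v) = F (br v)) \<and>
      (\<forall>f. card {n \<in> ?M. F n = f} \<le> card {v \<in> {1..<N}. F (bl v) = f} + 1)"
    by (intro component_labelling bl br finite_atLeastLessThan)
  then obtain F :: "'s option \<Rightarrow> 's option"
    where F: "\<And>v. v \<in> {1..<N} \<Longrightarrow> F (bl v) = F (br v)"
      and cnt: "\<And>f. card {n \<in> ?M. F n = f} \<le> card {v \<in> {1..<N}. F (bl v) = f} + 1"
    by (elim exE conjE) blast
  \<comment> \<open>The unbounded cell at the top is followed through all slabs. Slab
    \<open>N\<close> is empty, so there it is the bottom cell \<open>None\<close>.\<close>
  have chain: "F (topmost (Suc 0) (active (Suc 0))) = F (topmost k (active k))" if "k \<in> {1..N}" for k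
    using that
  proof (induction k)
    case (Suc k)
    then show ?case using top_active_step[of F k] F[of k] by (cases "k = 0") auto
  qed auto
  have bl0: "bl 0 = None" by (simp add: bl_def)
  \<comment> \<open>Every segment of the first proper slab starts at vertex 0, so
    \<open>br 0\<close> is the top cell of that slab.\<close>
  have "{t \<in> active (Suc 0). ht t (X 0) \<le> Y 0} = active (Suc 0)"
    by (auto simp: active_def) (metis ht_lft order_refl)
  then have "F (br 0) = F None"
    using chain[of N] assms by (simp add: br_def)
  then have all: "F (bl v) = F (br v)" if "v < N" for v
    using F[of v] that bl0 by (cases "v = 0") auto
  have inj: "card {s \<in> S. F (Some s) = f} = card (Some ` {s \<in> S. F (Some s) = f})" for f
    by (simp add: card_image)
  have "card {s \<in> S. F (Some s) = f} \<le> card {v. v < N \<and> F (bl v) = f} + 1" for f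
  proof -
    have "card {s \<in> S. F (Some s) = f} \<le> card {n \<in> ?M. F n = f}"
      unfolding inj using finite_S by (intro card_mono) auto
    moreover have "card {v \<in> {1..<N}. F (bl v) = f} \<le> card {v. v < N \<and> F (bl v) = f}"
      by (intro card_mono) auto
    ultimately show ?thesis using cnt[of f] by linarith
  qed
  moreover have "card {s \<in> S. F (Some s) = F None} + 1 \<le> card {v. v < N \<and> F (bl v) = F None}"
  proof -
    have "{n \<in> ?M. F n = F None} = insert None (Some ` {s \<in> S. F (Some s) = F None})" by auto
    then have "card {n \<in> ?M. F n = F None} = card {s \<in> S. F (Some s) = F None} + 1"
      using finite_S by (simp add: card_image)
    moreover have "{v. v < N \<and> F (bl v) = F None} = insert 0 {v \<in> {1..<N}. F (bl v) = F None}"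
      using bl0 assms by (auto simp: Suc_le_eq)
    moreover have "finite {v \<in> {1..<N}. F (bl v) = F None}"
      by (rule finite_subset[of _ "{1..<N}"]) auto
    then have "card (insert 0 {v \<in> {1..<N}. F (bl v) = F None}) =
        card {v \<in> {1..<N}. F (bl v) = F None} + 1"
      by (subst card_insert_disjoint) auto
    ultimately show ?thesis using cnt[of "F None"] by presburger
  qed
  ultimately show ?thesis using all by (intro exI[of _ F]) simp
qed

end

subsection \<open>Angle sums of faces\<close>

text \<open>\<open>cw u\<close> and \<open>ccw u\<close> label the corners on the two sides of the
  half-edge \<open>u\<close>. By summation by parts a corner labelled \<open>f\<close> between
  consecutive \<open>s\<close> and \<open>t\<close> contributes
  \<open>\<delta> t - \<delta> s\<close>; \<open>R\<close> collects these angles, and the boundary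
  terms belong to the corner between the last and the first half-edge.\<close>

lemma turning_sum:
  fixes \<delta> :: "'s \<Rightarrow> real"
  assumes "successively (\<lambda>s t. \<delta> s < \<delta> t \<and> ccw s = cw t) (s # ss)"
  shows "\<exists>R\<ge>0. (\<Sum>u\<leftarrow>s # ss. (of_bool (cw u = f) - of_bool (ccw u = f)) * \<delta> u) =
      of_bool (cw s = f) * \<delta> s - of_bool (ccw (last (s # ss)) = f) * \<delta> (last (s # ss)) + R \<and>
      ((\<exists>u\<in>set ss. cw u = f) \<longrightarrow> R > 0) \<and>
      ((\<exists>u\<in>set (s # ss). ccw u = f) \<longrightarrow> R > 0 \<or> ccw (last (s # ss)) = f)"
  using assms
proof (induction ss arbitrary: s)
  case Nil
  show ?case by (intro exI[of _ 0]) (auto simp: algebra_simps)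
next
  case (Cons t ss)
  then have st: "\<delta> s < \<delta> t" "ccw s = cw t" by simp_all
  from Cons.IH[of t] Cons.prems obtain R where R: "R \<ge> 0"
    "(\<Sum>u\<leftarrow>t # ss. (of_bool (cw u = f) - of_bool (ccw u = f)) * \<delta> u) =
      of_bool (cw t = f) * \<delta> t - of_bool (ccw (last (t # ss)) = f) * \<delta> (last (t # ss)) + R"
    "(\<exists>u\<in>set ss. cw u = f) \<longrightarrow> R > 0"
    "(\<exists>u\<in>set (t # ss). ccw u = f) \<longrightarrow> R > 0 \<or> ccw (last (t # ss)) = f" by auto
  let ?R = "R + of_bool (cw t = f) * (\<delta> t - \<delta> s)"
  have "?R \<ge> 0" "cw t = f \<Longrightarrow> ?R > 0" "R > 0 \<Longrightarrow> ?R > 0"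
    using R(1) st by (auto intro!: add_pos_nonneg add_nonneg_pos add_nonneg_nonneg)
  moreover have "(\<Sum>u\<leftarrow>s # t # ss. (of_bool (cw u = f) - of_bool (ccw u = f)) * \<delta> u) =
      of_bool (cw s = f) * \<delta> s - of_bool (ccw (last (s # t # ss)) = f) * \<delta> (last (s # t # ss)) + ?R"
    using R(2) st by (simp add: algebra_simps)
  ultimately show ?case using R(3,4) st
    by (intro exI[of _ ?R]) auto
qed

text \<open>The corners at a vertex lie between cyclically consecutive half-edges. When the directions
  \<open>\<delta>\<close> are listed increasingly, only the corner \<open>t0\<close> between the last and the first half-edge needs
  the correction \<open>2 * pi\<close>; the sum below is the total angle of the corners labelled \<open>f\<close>.\<close>

lemma corner_sum:
  fixes \<delta> :: "'s \<Rightarrow> real" and f :: 'l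
  assumes "finite H" "inj_on \<delta> H"
    and bnd: "\<And>s t. s \<in> H \<Longrightarrow> t \<in> H \<Longrightarrow> \<delta> s - \<delta> t < 2 * pi"
    and cons: "\<And>s t. s \<in> H \<Longrightarrow> t \<in> H \<Longrightarrow> \<delta> s < \<delta> t \<Longrightarrow>
      (\<And>u. u \<in> H \<Longrightarrow> \<not> (\<delta> s < \<delta> u \<and> \<delta> u < \<delta> t)) \<Longrightarrow> ccw s = cw t"
    and fst: "\<And>s. s \<in> H \<Longrightarrow> (\<And>u. u \<in> H \<Longrightarrow> \<delta> s \<le> \<delta> u) \<Longrightarrow> cw s = t0"
    and lst: "\<And>s. s \<in> H \<Longrightarrow> (\<And>u. u \<in> H \<Longrightarrow> \<delta> u \<le> \<delta> s) \<Longrightarrow> ccw s = t0"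
  defines "A \<equiv> (\<Sum>s\<in>H. (of_bool (cw s = f) - of_bool (ccw s = f)) * \<delta> s) + 2 * pi * of_bool (t0 = f)"
  shows "A \<ge> 0" and "s \<in> H \<Longrightarrow> cw s = f \<or> ccw s = f \<Longrightarrow> A > 0"
proof -
  have "A \<ge> 0 \<and> ((\<exists>s\<in>H. cw s = f \<or> ccw s = f) \<longrightarrow> A > 0)"
  proof (cases "H = {}")
    case False
    obtain hs0 where hs0: "set hs0 = H" "distinct hs0" using finite_distinct_list[OF assms(1)] by blast
    define hs where "hs = sort_key \<delta> hs0"
    have hs: "set hs = H" "distinct hs" using hs0 by (simp_all add: hs_def)
    have "distinct (map \<delta> hs)" using hs assms(2) by (simp add: distinct_map)
    moreover have "sorted (map \<delta> hs)" by (simp add: hs_def)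
    ultimately have "sorted_wrt (<) (map \<delta> hs)" by (simp add: strict_sorted_iff)
    then have hs_less: "sorted_wrt (\<lambda>x y. \<delta> x < \<delta> y) hs" by (simp add: sorted_wrt_map)
    have mono: "\<delta> (hs ! i) < \<delta> (hs ! j)" if "i < j" "j < length hs" for i j
      using hs_less that by (simp add: sorted_wrt_iff_nth_less)
    have mono_le: "\<delta> (hs ! i) \<le> \<delta> (hs ! j)" if "i \<le> j" "j < length hs" for i j
      using mono[of i j] that by (cases "i = j") auto
    have in_H: "hs ! i \<in> H" if "i < length hs" for i using that hs(1) by auto
    have "ccw (hs ! i) = cw (hs ! Suc i)" if "Suc i < length hs" for i
    proof (rule cons)
      fix u assume "u \<in> H"
      then obtain j where j: "j < length hs" "u = hs ! j" using hs(1) by (metis in_set_conv_nth)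
      show "\<not> (\<delta> (hs ! i) < \<delta> u \<and> \<delta> u < \<delta> (hs ! Suc i))"
        using mono_le[of j i] mono_le[of "Suc i" j] j that by (cases "j \<le> i") auto
    qed (use that in_H mono in auto)
    then have succ: "successively (\<lambda>s t. \<delta> s < \<delta> t \<and> ccw s = cw t) hs"
      using mono by (simp add: successively_conv_nth)
    obtain a ss where a: "hs = a # ss" using False hs(1) by (cases hs) auto
    define z where "z = last hs"
    have z: "z = hs ! (length hs - 1)" "z \<in> H" "a = hs ! 0" "a \<in> H"
      using a hs(1) by (auto simp: z_def last_conv_nth)
    have le: "\<delta> a \<le> \<delta> u \<and> \<delta> u \<le> \<delta> z" if "u \<in> H" for u
    proof -
      obtain j where j: "j < length hs" "u = hs ! j" using hs(1) \<open>u \<in> H\<close> by (metis in_set_conv_nth)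
      then show ?thesis using mono_le[of 0 j] mono_le[of j "length hs - 1"] z by auto
    qed
    have t0: "cw a = t0" "ccw z = t0" using fst[of a] lst[of z] le z by auto
    obtain R where R: "R \<ge> 0" "(\<Sum>u\<leftarrow>hs. (of_bool (cw u = f) - of_bool (ccw u = f)) * \<delta> u) =
        of_bool (cw a = f) * \<delta> a - of_bool (ccw z = f) * \<delta> z + R"
      "(\<exists>u\<in>set ss. cw u = f) \<longrightarrow> R > 0"
      "(\<exists>u\<in>set hs. ccw u = f) \<longrightarrow> R > 0 \<or> ccw z = f"
      using turning_sum[OF succ[unfolded a], of f] unfolding a[symmetric] z_def[symmetric] by blast
    have "(\<Sum>u\<leftarrow>hs. (of_bool (cw u = f) - of_bool (ccw u = f)) * \<delta> u) =
        (\<Sum>u\<in>H. (of_bool (cw u = f) - of_bool (ccw u = f)) * \<delta> u)"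
      by (simp only: sum_list_distinct_conv_sum_set[OF hs(2)] hs(1))
    \<comment> \<open>The boundary terms and \<open>2 * pi\<close> combine to the angle of the
      corner \<open>t0\<close>, which is positive by \<open>bnd\<close>.\<close>
    then have A: "A = of_bool (t0 = f) * (2 * pi - (\<delta> z - \<delta> a)) + R"
      using R(2) t0 by (simp add: A_def algebra_simps)
    have pos: "2 * pi - (\<delta> z - \<delta> a) > 0" using bnd[of z a] z by simp
    have "A > 0" if "s \<in> H" "cw s = f \<or> ccw s = f" for s
    proof (cases "t0 = f")
      case True
      then show ?thesis using A pos R(1) by simp
    next
      case False
      have "s \<in> set hs" using that hs by simp
      then have "R > 0" using that(2) R(3,4) False t0 a by auto
      then show ?thesis using A False by simp
    qed
    moreover have "A \<ge> 0" using A pos R(1) by simp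
    ultimately show ?thesis by blast
  qed (simp add: A_def)
  then show "A \<ge> 0" and "s \<in> H \<Longrightarrow> cw s = f \<or> ccw s = f \<Longrightarrow> A > 0" by blast+
qed

section \<open>Half-edges at a vertex in angular order\<close>

context sweep
begin

definition star :: "nat \<Rightarrow> 's set" where
  "star v = {s \<in> S. lft s = v \<or> rgt s = v}"

text \<open>Directions are taken in the interval from \<open>- 3 * pi / 2\<close> to
  \<open>pi / 2\<close>. The cut runs along the upward vertical, so the corner at which the angles
  wrap around is the one directly above \<open>v\<close>.\<close>

definition dir :: "nat \<Rightarrow> 's \<Rightarrow> real" where
  "dir v s = (if lft s = v then arctan (sl s) else arctan (sl s) - pi)"

lemma active_left: "s \<in> S \<Longrightarrow> rgt s = v \<Longrightarrow> s \<in> active v"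
  using S_less[of s] by (auto simp: active_def)

lemma active_right: "s \<in> S \<Longrightarrow> lft s = v \<Longrightarrow> s \<in> active (Suc v)"
  using S_less[of s] by (auto simp: active_def)

text \<open>Looking left from a common right end reverses the order of the slopes.\<close>

lemma mid_less_slope_left:
  assumes "s \<in> S" "rgt s = v" "t \<in> S" "rgt t = v"
  shows "ht s (mid v) < ht t (mid v) \<longleftrightarrow> sl t < sl s"
proof -
  have "mid v < X v" using mid_bounds[of v] S_less[of s] assms by auto
  moreover have "ht s (mid v) = Y v - sl s * (X v - mid v)" "ht t (mid v) = Y v - sl t * (X v - mid v)"
    using ht_diff[of s "X v" "mid v"] ht_diff[of t "X v" "mid v"] ht_rgt[of s] ht_rgt[of t] assms by auto
  ultimately show ?thesis by simp
qed

lemma mid_less_slope_right: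
  assumes "s \<in> S" "lft s = v" "t \<in> S" "lft t = v"
  shows "ht s (mid (Suc v)) < ht t (mid (Suc v)) \<longleftrightarrow> sl s < sl t"
proof -
  have "X v < mid (Suc v)" using mid_bounds[of "Suc v"] S_less[of s] assms by auto
  moreover have "ht s (mid (Suc v)) = Y v + sl s * (mid (Suc v) - X v)"
    "ht t (mid (Suc v)) = Y v + sl t * (mid (Suc v) - X v)"
    using assms by (auto simp: height_def)
  ultimately show ?thesis by simp
qed

lemma slope_inj_left: "s \<in> S \<Longrightarrow> rgt s = v \<Longrightarrow> t \<in> S \<Longrightarrow> rgt t = v \<Longrightarrow> s \<noteq> t \<Longrightarrow> sl s \<noteq> sl t"
  using mid_less_slope_left[of s v t] mid_less_slope_left[of t v s] mid_neq[of s v t] active_left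
  by force

lemma slope_inj_right: "s \<in> S \<Longrightarrow> lft s = v \<Longrightarrow> t \<in> S \<Longrightarrow> lft t = v \<Longrightarrow> s \<noteq> t \<Longrightarrow> sl s \<noteq> sl t"
  using mid_less_slope_right[of s v t] mid_less_slope_right[of t v s] mid_neq[of s "Suc v" t] active_right
  by force

lemma star_cases:
  assumes "s \<in> star v"
  obtains (right) "s \<in> S" "lft s = v" "dir v s = arctan (sl s)" "- (pi / 2) < dir v s" "dir v s < pi / 2"
  | (left) "s \<in> S" "rgt s = v" "lft s \<noteq> v" "dir v s = arctan (sl s) - pi"
      "- 3 * pi / 2 < dir v s" "dir v s < - (pi / 2)"
  using assms arctan_bounded[of "sl s"] S_less[of s]
  by (cases "lft s = v") (auto simp: star_def dir_def)

lemma dir_inj: "inj_on (dir v) (star v)"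
proof (rule inj_onI, rule ccontr)
  fix s t assume st: "s \<in> star v" "t \<in> star v" "dir v s = dir v t" "s \<noteq> t"
  from st(1) show False
  proof (cases rule: star_cases)
    case s: right
    from st(2) show ?thesis
    proof (cases rule: star_cases)
      case right
      then show ?thesis using slope_inj_right[of s v t] s st by (auto simp: arctan_eq_iff)
    qed (use s st in auto)
  next
    case s: left
    from st(2) show ?thesis
    proof (cases rule: star_cases)
      case left
      then show ?thesis using slope_inj_left[of s v t] s st by (auto simp: arctan_eq_iff)
    qed (use s st in auto)
  qed
qed

lemma dir_diff_less:
  assumes "s \<in> star v" "t \<in> star v" shows "dir v s - dir v t < 2 * pi"
proof -
  have "- 3 * pi / 2 < dir v u \<and> dir v u < pi / 2" if "u \<in> star v" for u
    using that pi_gt_zero by (cases rule: star_cases) auto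
  from this[OF assms(1)] this[OF assms(2)] show ?thesis by simp
qed

text \<open>Contrapositive of \<open>mid_less_right\<close>; strictness is lost because both
  segments may end in the same vertex.\<close>

lemma height_le_right:
  assumes "s \<in> active k" "t \<in> active k" "ht s (mid k) < ht t (mid k)"
  shows "ht s (X k) \<le> ht t (X k)"
  using mid_less_right[OF assms(2,1)] assms(3) by fastforce

lemma height_le_left:
  assumes "s \<in> active (Suc k)" "t \<in> active (Suc k)" "ht s (mid (Suc k)) < ht t (mid (Suc k))"
  shows "ht s (X k) \<le> ht t (X k)"
  using mid_less_left[OF assms(2,1)] assms(3) by fastforce

lemma meet_at_vertex_left:
  assumes "s \<in> active (Suc k)" "t \<in> active (Suc k)" "s \<noteq> t" "ht s (X k) = ht t (X k)"
  shows "ht s (X k) = Y k"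
proof (rule ccontr)
  assume ne: "ht s (X k) \<noteq> Y k"
  then have "s \<in> active k" "t \<in> active k"
    using assms active_Suc_iff[of s k] active_Suc_iff[of t k] by auto
  then show False using meet_at_vertex[of s k t] assms ne by simp
qed

text \<open>The topmost member of such a set names the cell directly below \<open>v\<close>, on the
  left or on the right.\<close>

abbreviation "lo_left v \<equiv> {t \<in> active v. ht t (X v) < Y v}"
abbreviation "lo_right v \<equiv> {t \<in> active (Suc v). ht t (X v) < Y v}"

text \<open>The steepest segment ending in \<open>v\<close> is the lowest on the left, so the cell
  under it is the cell directly below \<open>v\<close>.\<close>

lemma below_bottom_left:
  assumes s: "s \<in> S" "rgt s = v" and bot: "\<And>u. u \<in> S \<Longrightarrow> rgt u = v \<Longrightarrow> sl u \<le> sl s"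
  shows "below v s = topmost v (lo_left v)"
proof -
  have sY: "ht s (X v) = Y v" "s \<in> active v" using ht_rgt s active_left by auto
  have "ht t (mid v) < ht s (mid v) \<longleftrightarrow> ht t (X v) < Y v" if t: "t \<in> active v" for t
  proof
    assume *: "ht t (mid v) < ht s (mid v)"
    then have "ht t (X v) \<le> Y v" using height_le_right[OF t sY(2)] sY by simp
    moreover have "ht t (X v) \<noteq> Y v"
    proof
      assume "ht t (X v) = Y v"
      then have "rgt t = v" "t \<in> S" using active_ends[OF t] activeD[OF t] by auto
      then show False using mid_less_slope_left[of t v s] bot[of t] s * by auto
    qed
    ultimately show "ht t (X v) < Y v" by simp
  qed (use mid_less_right[OF t sY(2)] sY in simp)
  then show ?thesis by (auto simp: below_def intro!: arg_cong[of _ _ "topmost v"])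
qed

lemma below_bottom_right:
  assumes s: "s \<in> S" "lft s = v" and bot: "\<And>u. u \<in> S \<Longrightarrow> lft u = v \<Longrightarrow> sl s \<le> sl u"
  shows "below (Suc v) s = topmost (Suc v) (lo_right v)"
proof -
  have sY: "ht s (X v) = Y v" "s \<in> active (Suc v)" using s active_right by auto
  have "ht t (mid (Suc v)) < ht s (mid (Suc v)) \<longleftrightarrow> ht t (X v) < Y v" if t: "t \<in> active (Suc v)" for t
  proof
    assume *: "ht t (mid (Suc v)) < ht s (mid (Suc v))"
    then have "ht t (X v) \<le> Y v" using height_le_left[OF t sY(2)] sY by simp
    moreover have "ht t (X v) \<noteq> Y v"
    proof
      assume "ht t (X v) = Y v"
      then have "lft t = v" "t \<in> S" using active_starts[OF t] activeD[OF t] by auto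
      then show False using mid_less_slope_right[of t v s] bot[of t] s * by auto
    qed
    ultimately show "ht t (X v) < Y v" by simp
  qed (use mid_less_left[OF t sY(2)] sY in simp)
  then show ?thesis by (auto simp: below_def intro!: arg_cong[of _ _ "topmost (Suc v)"])
qed

text \<open>When nothing ends in \<open>v\<close>, no segment separates the cells directly above and
  directly below \<open>v\<close> on the left.\<close>

lemma bl_eq_lo: "(\<And>u. u \<in> S \<Longrightarrow> rgt u \<noteq> v) \<Longrightarrow> bl v = topmost v (lo_left v)"
  unfolding bl_def using active_ends[of _ v] activeD[of _ v]
  by (intro arg_cong[of _ _ "topmost v"] Collect_cong) fastforce

lemma br_eq_lo: "(\<And>u. u \<in> S \<Longrightarrow> lft u \<noteq> v) \<Longrightarrow> br v = topmost (Suc v) (lo_right v)"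
  unfolding br_def using active_starts[of _ v] activeD[of _ "Suc v"]
  by (intro arg_cong[of _ _ "topmost (Suc v)"] Collect_cong) fastforce

lemma bl_eq_Some:
  assumes s: "s \<in> S" "rgt s = v" and top: "\<And>u. u \<in> S \<Longrightarrow> rgt u = v \<Longrightarrow> sl s \<le> sl u"
  shows "bl v = Some s"
  unfolding bl_def
proof (rule top_eqI)
  have sY: "ht s (X v) = Y v" "s \<in> active v" using ht_rgt s active_left by auto
  then show "s \<in> {t \<in> active v. ht t (X v) \<le> Y v}" by simp
  fix t assume t: "t \<in> {t \<in> active v. ht t (X v) \<le> Y v}" "t \<noteq> s"
  show "ht t (mid v) < ht s (mid v)"
  proof (cases "ht t (X v) = Y v")
    case True
    then have "rgt t = v" "t \<in> S" using active_ends[of t v] activeD[of t v] t by auto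
    then show ?thesis
      using mid_less_slope_left[of t v s] top[of t] s slope_inj_left[of s v t] t(2) by fastforce
  qed (use mid_less_right[of t v s] sY t in auto)
qed auto

lemma br_eq_Some:
  assumes s: "s \<in> S" "lft s = v" and top: "\<And>u. u \<in> S \<Longrightarrow> lft u = v \<Longrightarrow> sl u \<le> sl s"
  shows "br v = Some s"
  unfolding br_def
proof (rule top_eqI)
  have sY: "ht s (X v) = Y v" "s \<in> active (Suc v)" using s active_right by auto
  then show "s \<in> {t \<in> active (Suc v). ht t (X v) \<le> Y v}" by simp
  fix t assume t: "t \<in> {t \<in> active (Suc v). ht t (X v) \<le> Y v}" "t \<noteq> s"
  show "ht t (mid (Suc v)) < ht s (mid (Suc v))"
  proof (cases "ht t (X v) = Y v")
    case True
    then have "lft t = v" "t \<in> S" using active_starts[of t v] activeD[of t "Suc v"] t by auto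
    then show ?thesis
      using mid_less_slope_right[of t v s] top[of t] s slope_inj_right[of s v t] t(2) by fastforce
  qed (use mid_less_left[of t "Suc v" s] sY t in auto)
qed auto

text \<open>A segment strictly between \<open>s\<close> and \<open>t\<close> in the slab would be
  squeezed into \<open>v\<close> and would have a slope strictly between theirs.\<close>

lemma below_next_left:
  assumes s: "s \<in> S" "rgt s = v" and t: "t \<in> S" "rgt t = v" and less: "sl s < sl t"
    and cons: "\<And>u. u \<in> S \<Longrightarrow> rgt u = v \<Longrightarrow> \<not> (sl s < sl u \<and> sl u < sl t)"
  shows "below v s = Some t"
  unfolding below_def
proof (rule top_eqI)
  have sY: "ht s (X v) = Y v" "s \<in> active v" "ht t (X v) = Y v" "t \<in> active v"
    using ht_rgt[of s] ht_rgt[of t] s t active_left by auto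
  show "t \<in> {u \<in> active v. ht u (mid v) < ht s (mid v)}"
    using sY mid_less_slope_left[of t v s] s t less by simp
  fix u assume u: "u \<in> {u \<in> active v. ht u (mid v) < ht s (mid v)}" "u \<noteq> t"
  show "ht u (mid v) < ht t (mid v)"
  proof (rule ccontr)
    assume "\<not> ?thesis"
    then have *: "ht t (mid v) < ht u (mid v)" using mid_neq[of u v t] u sY by force
    then have "ht u (X v) = Y v"
      using height_le_right[of u v s] height_le_right[of t v u] u sY by auto
    then have "rgt u = v" "u \<in> S" using active_ends[of u v] activeD[of u v] u by auto
    then show False
      using cons[of u] mid_less_slope_left[of u v s] mid_less_slope_left[of t v u] s t u * by auto
  qed
qed auto

lemma below_next_right:
  assumes s: "s \<in> S" "lft s = v" and t: "t \<in> S" "lft t = v" and less: "sl s < sl t"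
    and cons: "\<And>u. u \<in> S \<Longrightarrow> lft u = v \<Longrightarrow> \<not> (sl s < sl u \<and> sl u < sl t)"
  shows "below (Suc v) t = Some s"
  unfolding below_def
proof (rule top_eqI)
  let ?m = "mid (Suc v)"
  have sY: "ht s (X v) = Y v" "s \<in> active (Suc v)" "ht t (X v) = Y v" "t \<in> active (Suc v)"
    using s t ht_lft[of s] ht_lft[of t] active_right by auto
  show "s \<in> {u \<in> active (Suc v). ht u ?m < ht t ?m}"
    using sY mid_less_slope_right[of s v t] s t less by simp
  fix u assume u: "u \<in> {u \<in> active (Suc v). ht u ?m < ht t ?m}" "u \<noteq> s"
  show "ht u ?m < ht s ?m"
  proof (rule ccontr)
    assume "\<not> ?thesis"
    then have *: "ht s ?m < ht u ?m" using mid_neq[of u "Suc v" s] u sY by force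
    then have "ht u (X v) = Y v"
      using height_le_left[of u v t] height_le_left[of s v u] u sY by auto
    then have "lft u = v" "u \<in> S" using active_starts[of u v] activeD[of u "Suc v"] u by auto
    then show False
      using cons[of u] mid_less_slope_right[of u v t] mid_less_slope_right[of s v u] s t u * by auto
  qed
qed auto

end

section \<open>Face labels of segment sides and of corners\<close>

locale labelled_sweep = sweep +
  fixes F :: "'a option \<Rightarrow> 'b"
  assumes F_step: "v < N \<Longrightarrow> F (bl v) = F (br v)"
begin

definition up :: "'a \<Rightarrow> 'b" where "up s = F (Some s)"
text \<open>The last slab met by \<open>s\<close> serves as representative;
  \<open>below_const\<close> shows that every slab met by \<open>s\<close> gives the same
  label.\<close>

definition dn :: "'a \<Rightarrow> 'b" where "dn s = F (below (rgt s) s)"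
definition over :: "nat \<Rightarrow> 'b" where "over v = F (bl v)"

text \<open>The clockwise side of a half-edge leaving \<open>v\<close> lies below it if it points
  right and above it if it points left.\<close>

definition cw :: "nat \<Rightarrow> 'a \<Rightarrow> 'b" where "cw v s = (if lft s = v then dn s else up s)"
definition ccw :: "nat \<Rightarrow> 'a \<Rightarrow> 'b" where "ccw v s = (if lft s = v then up s else dn s)"

text \<open>Since \<open>s\<close> misses vertex \<open>k\<close>, the segments under
  \<open>s\<close> either all pass strictly below that vertex or include all segments at or below
  it, as \<open>top_step\<close> requires.\<close>

lemma below_step:
  assumes "s \<in> S" "lft s < k" "k < rgt s"
  shows "F (below k s) = F (below (Suc k) s)"
proof -
  have s: "s \<in> active k" "s \<in> active (Suc k)" "k < N" and sY: "ht s (X k) \<noteq> Y k"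
    using assms no_inner[of s k] S_less[of s] by (auto simp: active_def)
  have l: "ht t (mid k) < ht s (mid k) \<longleftrightarrow> ht t (X k) < ht s (X k)" if "t \<in> active k" for t
    using that s sY mid_less_right[of t k s] mid_less_right[of s k t] meet_at_vertex[of s k t]
    by (cases "t = s") fastforce+
  have r: "ht t (mid (Suc k)) < ht s (mid (Suc k)) \<longleftrightarrow> ht t (X k) < ht s (X k)"
    if "t \<in> active (Suc k)" for t
    using that s sY mid_less_left[of t "Suc k" s] mid_less_left[of s "Suc k" t]
      meet_at_vertex_left[of s k t]
    by (cases "t = s") fastforce+
  show ?thesis unfolding below_def
    using l r active_Suc_iff[of _ k] sY F_step[OF s(3)]
    by (intro top_step) (cases "ht s (X k) < Y k"; force)+
qed

lemma below_const:
  assumes "s \<in> S" "lft s < k" "k \<le> rgt s"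
  shows "F (below k s) = dn s"
  using assms(3,2)
proof (induction k rule: inc_induct)
  case (step n)
  then show ?case using below_step[of s n] assms(1) by simp
qed (simp add: dn_def)

lemma lo_step: "v < N \<Longrightarrow> F (topmost v (lo_left v)) = F (topmost (Suc v) (lo_right v))"
  using active_Suc_iff F_step by (intro top_step) auto

lemma dn_left: "s \<in> S \<Longrightarrow> rgt s = v \<Longrightarrow> dn s = F (below v s)"
  by (simp add: dn_def)

lemma dn_right: "s \<in> S \<Longrightarrow> lft s = v \<Longrightarrow> dn s = F (below (Suc v) s)"
  using below_const[of s "Suc v"] S_less[of s] by auto

text \<open>Two consecutive half-edges on the same side of \<open>v\<close> enclose a single cell.
  If \<open>s\<close> points left and \<open>t\<close> points right, the corner between them
  contains the downward vertical.\<close>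

lemma ccw_eq_cw:
  assumes st: "s \<in> star v" "t \<in> star v" "dir v s < dir v t"
    and cons: "\<And>u. u \<in> star v \<Longrightarrow> \<not> (dir v s < dir v u \<and> dir v u < dir v t)"
  shows "ccw v s = cw v t"
  using st(1)
proof (cases rule: star_cases)
  case s: right
  from st(2) show ?thesis
  proof (cases rule: star_cases)
    case t: right
    have "below (Suc v) t = Some s"
    proof (rule below_next_right)
      fix u assume "u \<in> S" "lft u = v"
      then show "\<not> (sl s < sl u \<and> sl u < sl t)"
        using cons[of u] s t by (auto simp: star_def dir_def arctan_less_iff)
    qed (use s t st in \<open>auto simp: arctan_less_iff\<close>)
    then show ?thesis using dn_right[of t v] s t by (simp add: cw_def ccw_def up_def)
  qed (use s st in auto)
next
  case s: left
  from st(2) show ?thesis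
  proof (cases rule: star_cases)
    case t: left
    have "below v s = Some t"
    proof (rule below_next_left)
      fix u assume u: "u \<in> S" "rgt u = v"
      then have "lft u \<noteq> v" using S_less[of u] by auto
      then show "\<not> (sl s < sl u \<and> sl u < sl t)"
        using cons[of u] s t u by (auto simp: star_def dir_def arctan_less_iff)
    qed (use s t st in \<open>auto simp: arctan_less_iff\<close>)
    then show ?thesis using dn_left[of s v] s t by (simp add: cw_def ccw_def up_def)
  next
    case t: right
    \<comment> \<open>Both \<open>s\<close> and \<open>t\<close> are lowest on their sides, so the
      corner consists of the two cells directly below \<open>v\<close>, which \<open>lo_step\<close>
      identifies.\<close>
    have "below v s = topmost v (lo_left v)"
    proof (rule below_bottom_left)
      fix u assume u: "u \<in> S" "rgt u = v"
      then have "u \<in> star v" "lft u \<noteq> v" using S_less[of u] by (auto simp: star_def)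
      moreover from this have "dir v u < - (pi / 2)" by (auto elim: star_cases)
      ultimately show "sl u \<le> sl s"
        using cons[of u] s t u by (auto simp: dir_def arctan_less_iff not_less[symmetric])
    qed (use s in auto)
    moreover have "below (Suc v) t = topmost (Suc v) (lo_right v)"
    proof (rule below_bottom_right)
      fix u assume u: "u \<in> S" "lft u = v"
      then have "u \<in> star v" by (auto simp: star_def)
      moreover from this u have "- (pi / 2) < dir v u" by (auto elim: star_cases)
      ultimately show "sl t \<le> sl u"
        using cons[of u] s t u by (auto simp: dir_def arctan_less_iff not_less[symmetric])
    qed (use t in auto)
    moreover have "v < N" using s S_less by auto
    ultimately show ?thesis
      using lo_step[of v] dn_left[of s v] dn_right[of t v] s t by (simp add: cw_def ccw_def)
  qed
qed

text \<open>The first half-edge counterclockwise from the upward vertical borders the corner above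
  \<open>v\<close>. If it points right, nothing ends in \<open>v\<close>, and that corner extends
  around the left of \<open>v\<close> to the cell directly below.\<close>

lemma cw_first:
  assumes s: "s \<in> star v" and first: "\<And>u. u \<in> star v \<Longrightarrow> dir v s \<le> dir v u"
  shows "cw v s = over v"
  using s
proof (cases rule: star_cases)
  case left
  have "bl v = Some s"
  proof (rule bl_eq_Some)
    fix u assume u: "u \<in> S" "rgt u = v"
    then have "u \<in> star v" "lft u \<noteq> v" using S_less[of u] by (auto simp: star_def)
    then show "sl s \<le> sl u" using first[of u] left by (auto simp: dir_def arctan_le_iff)
  qed (use left in auto)
  then show ?thesis using left by (simp add: cw_def over_def up_def)
next
  case right
  have "bl v = topmost v (lo_left v)"
  proof (rule bl_eq_lo)
    fix u assume u: "u \<in> S"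
    show "rgt u \<noteq> v"
    proof
      assume "rgt u = v"
      then have "u \<in> star v" "lft u \<noteq> v" using S_less[of u] u by (auto simp: star_def)
      moreover from this have "dir v u < - (pi / 2)" by (auto elim: star_cases)
      ultimately show False using first[of u] right by auto
    qed
  qed
  moreover have "below (Suc v) s = topmost (Suc v) (lo_right v)"
  proof (rule below_bottom_right)
    fix u assume u: "u \<in> S" "lft u = v"
    then have "u \<in> star v" by (auto simp: star_def)
    then show "sl s \<le> sl u" using first[of u] right u by (auto simp: dir_def arctan_le_iff)
  qed (use right in auto)
  moreover have "v < N" using right S_less[of s] by auto
  ultimately show ?thesis
    using lo_step[of v] dn_right[of s v] right by (simp add: cw_def over_def)
qed

lemma ccw_last:
  assumes s: "s \<in> star v" and last: "\<And>u. u \<in> star v \<Longrightarrow> dir v u \<le> dir v s"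
  shows "ccw v s = over v"
  using s
proof (cases rule: star_cases)
  case right
  have "br v = Some s"
  proof (rule br_eq_Some)
    fix u assume u: "u \<in> S" "lft u = v"
    then have "u \<in> star v" by (auto simp: star_def)
    then show "sl u \<le> sl s" using last[of u] right u by (auto simp: dir_def arctan_le_iff)
  qed (use right in auto)
  moreover have "v < N" using right S_less[of s] by auto
  ultimately show ?thesis using right F_step[of v] by (simp add: ccw_def over_def up_def)
next
  case left
  have "br v = topmost (Suc v) (lo_right v)"
  proof (rule br_eq_lo)
    fix u assume u: "u \<in> S"
    show "lft u \<noteq> v"
    proof
      assume "lft u = v"
      then have "u \<in> star v" using u by (auto simp: star_def)
      moreover from this \<open>lft u = v\<close> have "- (pi / 2) < dir v u" by (auto elim: star_cases)
      ultimately show False using last[of u] left by auto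
    qed
  qed
  moreover have "below v s = topmost v (lo_left v)"
  proof (rule below_bottom_left)
    fix u assume u: "u \<in> S" "rgt u = v"
    then have "u \<in> star v" "lft u \<noteq> v" using S_less[of u] by (auto simp: star_def)
    then show "sl u \<le> sl s" using last[of u] left u by (auto simp: dir_def arctan_le_iff)
  qed (use left in auto)
  moreover have "v < N" using left S_less[of s] by auto
  ultimately show ?thesis
    using lo_step[of v] F_step[of v] dn_left[of s v] left by (simp add: ccw_def over_def)
qed

section \<open>Angle sum of a face\<close>

text \<open>The total angle at \<open>v\<close> of the corners labelled \<open>f\<close>, in the
  form of \<open>corner_sum\<close>. An isolated point gives the full turn to the face around
  it.\<close>

definition angle_sum :: "'b \<Rightarrow> nat \<Rightarrow> real" where
  "angle_sum f v = (\<Sum>s\<in>star v. (of_bool (cw v s = f) - of_bool (ccw v s = f)) * dir v s) +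
     2 * pi * of_bool (over v = f)"

lemma finite_star: "finite (star v)"
  using finite_S by (simp add: star_def)

lemma angle_sum_nonneg: "angle_sum f v \<ge> 0"
  unfolding angle_sum_def
  by (rule corner_sum(1)[OF finite_star dir_inj dir_diff_less ccw_eq_cw cw_first ccw_last])

lemma angle_sum_pos: "s \<in> star v \<Longrightarrow> cw v s = f \<or> ccw v s = f \<Longrightarrow> angle_sum f v > 0"
  unfolding angle_sum_def
  by (rule corner_sum(2)[OF finite_star dir_inj dir_diff_less ccw_eq_cw cw_first ccw_last])

lemma sum_star:
  fixes g :: "nat \<Rightarrow> 'a \<Rightarrow> real"
  shows "(\<Sum>v<N. \<Sum>s\<in>star v. g v s) = (\<Sum>s\<in>S. g (lft s) s + g (rgt s) s)"
proof -
  have "(\<Sum>v<N. \<Sum>s\<in>star v. g v s) = (\<Sum>v<N. \<Sum>s\<in>S. of_bool (lft s = v \<or> rgt s = v) * g v s)"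
    unfolding star_def sum.inter_filter[OF finite_S] by (intro sum.cong refl) simp
  also have "\<dots> = (\<Sum>s\<in>S. \<Sum>v<N. of_bool (lft s = v \<or> rgt s = v) * g v s)"
    by (rule sum.swap)
  also have "\<dots> = (\<Sum>s\<in>S. g (lft s) s + g (rgt s) s)"
  proof (rule sum.cong[OF refl])
    fix s assume "s \<in> S"
    then have s: "lft s < rgt s" "rgt s < N" using S_less by auto
    have "(\<Sum>v<N. of_bool (lft s = v \<or> rgt s = v) * g v s) =
        (\<Sum>v\<in>{lft s, rgt s}. of_bool (lft s = v \<or> rgt s = v) * g v s)"
      using s by (intro sum.mono_neutral_right) auto
    then show "(\<Sum>v<N. of_bool (lft s = v \<or> rgt s = v) * g v s) = g (lft s) s + g (rgt s) s"
      using s by simp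
  qed
  finally show ?thesis .
qed

text \<open>The roles of \<open>up\<close> and \<open>dn\<close> are exchanged between the two ends
  of a segment, so the arctangents cancel and only the shift by \<open>pi\<close> at the right end
  survives.\<close>

lemma total_angle:
  "(\<Sum>v<N. angle_sum f v) = pi * ((\<Sum>s\<in>S. of_bool (dn s = f)) - (\<Sum>s\<in>S. of_bool (up s = f))) +
     2 * pi * (\<Sum>v<N. of_bool (over v = f))"
proof -
  let ?g = "\<lambda>v s. (of_bool (cw v s = f) - of_bool (ccw v s = f)) * dir v s"
  have "(\<Sum>v<N. \<Sum>s\<in>star v. ?g v s) = (\<Sum>s\<in>S. ?g (lft s) s + ?g (rgt s) s)"
    by (rule sum_star)
  also have "\<dots> = (\<Sum>s\<in>S. pi * (of_bool (dn s = f) - of_bool (up s = f)))"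
    using S_less by (intro sum.cong refl) (force simp: cw_def ccw_def dir_def algebra_simps)
  finally show ?thesis
    by (simp add: angle_sum_def sum.distrib sum_distrib_left sum_subtractf right_diff_distrib)
qed

end

subsection \<open>Counting bends\<close>

text \<open>Only \<open>D = 1\<close> needs an argument. For \<open>x = 0\<close>, positivity gives
  \<open>y > 2 * pi / \<alpha>\<close>, which is at least 3, hence \<open>y \<ge> 4\<close>; for
  \<open>x = 1\<close> it gives \<open>y > 1\<close>. The bound on \<open>\<alpha>\<close> enters in
  the first case.\<close>

lemma face_inequality:
  fixes x y :: nat and D :: int and \<alpha> :: real
  assumes "0 < \<alpha>" "\<alpha> \<le> 2 * pi / 3" "D \<le> 1"
    and nonneg: "(2 * pi - \<alpha>) * x + \<alpha> * y - 2 * pi * D \<ge> 0"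
    and pos: "x + y > 0 \<Longrightarrow> (2 * pi - \<alpha>) * x + \<alpha> * y - 2 * pi * D > 0"
  shows "4 * D \<le> 2 * int x + int y"
proof (cases "D = 1")
  case True
  have xy: "x + y > 0" 
  proof (rule ccontr)
    assume "\<not> ?thesis"
    then have "pi \<le> 0" using nonneg True by simp
    then show False using pi_gt_zero by linarith
  qed
  consider "x = 0" | "x = 1" | "x \<ge> 2" by linarith
  then show ?thesis
  proof cases
    case 1
    have "2 * pi < \<alpha> * y" using pos[OF xy] True 1 by simp
    also have "\<dots> \<le> 2 * pi / 3 * y" using assms(2) by (intro mult_right_mono) auto
    finally have "3 < real y" using pi_gt_zero by (simp add: field_simps)
    then show ?thesis using True by simp
  next
    case 2
    have "\<alpha> * 1 < \<alpha> * y" using pos[OF xy] True 2 by simp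
    then have "1 < y" using assms(1) by simp
    then show ?thesis using 2 True by simp
  qed (use True in auto)
qed (use assms(3) in auto)

lemma sum_of_bool_values:
  assumes "finite L" "\<And>a. a \<in> A \<Longrightarrow> g a \<in> L"
  shows "(\<Sum>f\<in>L. \<Sum>a\<in>A. of_bool (g a = f)) = (of_nat (card A) :: 'r :: semiring_1)"
proof -
  have "(\<Sum>f\<in>L. \<Sum>a\<in>A. of_bool (g a = f)) = (\<Sum>a\<in>A. \<Sum>f\<in>L. of_bool (g a = f) :: 'r)"
    by (rule sum.swap)
  also have "\<dots> = (\<Sum>a\<in>A. 1)"
    using assms by (intro sum.cong refl) (simp add: of_bool_def sum.delta)
  finally show ?thesis by simp
qed

text \<open>\<open>bend_angle\<close> is stated with cosines because the difference of the two
  values of \<open>dir\<close> may be \<open>\<alpha>\<close> or \<open>2 * pi - \<alpha>\<close> up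
  to sign. The two counts are those provided by \<open>exists_labelling\<close>.\<close>

locale bend_sweep = labelled_sweep N X Y S lft rgt F
  for N X Y and S :: "'a set" and lft rgt and F :: "'a option \<Rightarrow> 'b" +
  fixes B :: "nat set" and \<alpha> :: real
  assumes \<alpha>_pos: "0 < \<alpha>" and \<alpha>_le: "\<alpha> \<le> 2 * pi / 3"
    and B_less: "B \<subseteq> {..<N}" and B_nonempty: "B \<noteq> {}"
    and card_star_bend: "b \<in> B \<Longrightarrow> card (star b) = 2"
    and one_bend: "s \<in> S \<Longrightarrow> (lft s \<in> B) \<noteq> (rgt s \<in> B)"
    and bend_angle: "b \<in> B \<Longrightarrow> s \<in> star b \<Longrightarrow> t \<in> star b \<Longrightarrow> s \<noteq> t \<Longrightarrow>
      cos (dir b s - dir b t) = cos \<alpha>"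
    and face_count: "card {s \<in> S. F (Some s) = f} \<le> card {v. v < N \<and> F (bl v) = f} + 1"
    and outer_count: "card {s \<in> S. F (Some s) = F None} + 1 \<le> card {v. v < N \<and> F (bl v) = F None}"
begin

lemma finite_B: "finite B"
  using B_less finite_subset by blast

text \<open>\<open>p\<close> is the face on the convex side of the bend and \<open>q\<close> the
  face on its reflex side. Either of them may own the corner above \<open>b\<close>.\<close>

lemma bend_labels:
  assumes "b \<in> B"
  shows "\<exists>p q. (\<forall>f. angle_sum f b = \<alpha> * of_bool (p = f) + (2 * pi - \<alpha>) * of_bool (q = f)) \<and>
    (\<forall>s\<in>star b. {up s, dn s} = {p, q}) \<and> over b \<in> {p, q}"
proof -
  obtain s t where st: "star b = {s, t}" "dir b s < dir b t"
  proof -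
    obtain s t where st: "star b = {s, t}" "s \<noteq> t"
      using card_star_bend[OF assms] by (auto simp: card_2_iff)
    then have "dir b s \<noteq> dir b t" using dir_inj[of b] by (auto simp: inj_on_def)
    then show thesis using that[of s t] that[of t s] st by (cases "dir b s < dir b t") auto
  qed
  have mid: "ccw b s = cw b t" by (rule ccw_eq_cw) (use st in auto)
  have first: "cw b s = over b" by (rule cw_first) (use st in auto)
  have last: "ccw b t = over b" by (rule ccw_last) (use st in auto)
  \<comment> \<open>The angle of the corner avoiding the upward vertical; the other corner has angle
    \<open>2 * pi - \<omega>\<close>.\<close>
  define \<omega> where "\<omega> = dir b t - dir b s"
  have \<omega>: "0 < \<omega>" "\<omega> < 2 * pi" "cos \<omega> = cos \<alpha>"
    using st dir_diff_less[of t b s] bend_angle[OF assms, of t s] by (auto simp: \<omega>_def)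
  have "\<alpha> \<le> pi" using \<alpha>_le pi_gt_zero by linarith
  have "\<omega> = \<alpha> \<or> 2 * pi - \<omega> = \<alpha>"
  proof (cases "\<omega> \<le> pi")
    case True
    then show ?thesis using cos_inj_pi[of \<omega> \<alpha>] \<omega> \<alpha>_pos \<open>\<alpha> \<le> pi\<close> by simp
  next
    case False
    have "cos (2 * pi - \<omega>) = cos \<alpha>" using \<omega>(3) by (simp add: cos_diff)
    then show ?thesis using cos_inj_pi[of "2 * pi - \<omega>" \<alpha>] \<omega> \<alpha>_pos \<open>\<alpha> \<le> pi\<close> False by simp
  qed
  have "s \<noteq> t" using st by auto
  have angle: "angle_sum f b = \<omega> * of_bool (cw b t = f) + (2 * pi - \<omega>) * of_bool (over b = f)" for f
    using \<open>s \<noteq> t\<close> by (simp add: angle_sum_def st mid first last \<omega>_def algebra_simps)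
  have labels: "{up u, dn u} = {cw b t, over b}" if "u \<in> star b" for u
    using that st mid first last by (auto simp: cw_def ccw_def split: if_splits)
  from \<open>\<omega> = \<alpha> \<or> 2 * pi - \<omega> = \<alpha>\<close> show ?thesis
  proof
    assume "\<omega> = \<alpha>"
    then show ?thesis using angle labels by (intro exI[of _ "cw b t"] exI[of _ "over b"]) simp
  next
    assume "2 * pi - \<omega> = \<alpha>"
    then have "\<omega> = 2 * pi - \<alpha>" by simp
    then show ?thesis using angle labels
      by (intro exI[of _ "over b"] exI[of _ "cw b t"]) (simp add: insert_commute)
  qed
qed

lemma same_ends_eq:
  assumes "s \<in> S" "t \<in> S" "lft s = lft t" "rgt s = rgt t"
  shows "s = t"
  using slope_inj_right[of s "lft t" t] assms by auto

lemma bend_end: "s \<in> S \<Longrightarrow> \<exists>b\<in>B. s \<in> star b"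
  using one_bend[of s] by (auto simp: star_def)

lemma sum_bends:
  fixes g :: "'a \<Rightarrow> real"
  shows "(\<Sum>b\<in>B. \<Sum>s\<in>star b. g s) = (\<Sum>s\<in>S. g s)"
proof -
  have "(\<Sum>b\<in>B. \<Sum>s\<in>star b. g s) = (\<Sum>v<N. \<Sum>s\<in>star v. of_bool (v \<in> B) * g s)"
    using B_less by (intro sum.mono_neutral_cong_left) (auto simp: finite_star)
  also have "\<dots> = (\<Sum>s\<in>S. of_bool (lft s \<in> B) * g s + of_bool (rgt s \<in> B) * g s)"
    by (rule sum_star)
  also have "\<dots> = (\<Sum>s\<in>S. g s)"
    using one_bend by (intro sum.cong refl) auto
  finally show ?thesis .
qed

lemma card_S: "card S = 2 * card B"
proof -
  have "real (card S) = (\<Sum>b\<in>B. \<Sum>s\<in>star b. 1)" using sum_bends[of "\<lambda>_. 1"] by simp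
  also have "\<dots> = 2 * real (card B)" using card_star_bend by simp
  finally show ?thesis by linarith
qed

text \<open>The weight \<open>2 * x + y - 4 * D\<close> is nonnegative for every face and at least 6
  for the outer one. The weights sum to \<open>3 * card B - 4 * (card S - N)\<close>, where
  \<open>card S = 2 * card B\<close>.\<close>

lemma edge_bound: "5 * card B + 6 \<le> 4 * N"
proof -
  obtain p q where pq: "\<And>b f. b \<in> B \<Longrightarrow>
        angle_sum f b = \<alpha> * of_bool (p b = f) + (2 * pi - \<alpha>) * of_bool (q b = f)"
      "\<And>b s. b \<in> B \<Longrightarrow> s \<in> star b \<Longrightarrow> {up s, dn s} = {p b, q b}"
      "\<And>b. b \<in> B \<Longrightarrow> over b \<in> {p b, q b}"
    using bend_labels by metis
  define x y where "x f = card {b \<in> B. p b = f}" and "y f = card {b \<in> B. q b = f}" for f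
  define D where "D f = int (card {s \<in> S. up s = f}) - int (card {v. v < N \<and> over v = f})" for f
  have card_sum: "(\<Sum>a\<in>A. of_bool (P a)) = real (card {a \<in> A. P a})" if "finite A" for A :: "'z set" and P
    using that by (simp add: sum_of_bool_eq Collect_conj_eq Int_commute)
  have x: "real (x f) = (\<Sum>b\<in>B. of_bool (p b = f))" and y: "real (y f) = (\<Sum>b\<in>B. of_bool (q b = f))" for f
    using card_sum[OF finite_B] by (simp_all add: x_def y_def)
  have D: "real_of_int (D f) = (\<Sum>s\<in>S. of_bool (up s = f)) - (\<Sum>v<N. of_bool (over v = f))" for f
    using card_sum[OF finite_S] card_sum[of "{..<N}"] by (simp add: D_def)
  have sides: "of_bool (up s = f) + of_bool (dn s = f) = (of_bool (p b = f) + of_bool (q b = f) :: real)"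
    if "b \<in> B" "s \<in> star b" for b s f
  proof -
    have "up s = p b \<and> dn s = q b \<or> up s = q b \<and> dn s = p b"
      using pq(2)[OF that] by (simp add: doubleton_eq_iff)
    then show ?thesis by (elim disjE conjE) (simp_all only: add.commute)
  qed
  \<comment> \<open>Each bend is counted twice, since both of its segments have the sides
    \<open>p b\<close> and \<open>q b\<close>.\<close>
  have updn: "(\<Sum>s\<in>S. of_bool (up s = f)) + (\<Sum>s\<in>S. of_bool (dn s = f)) = 2 * (real (x f) + real (y f))" for f
  proof -
    have "(\<Sum>s\<in>S. of_bool (up s = f)) + (\<Sum>s\<in>S. of_bool (dn s = f)) =
        (\<Sum>b\<in>B. \<Sum>s\<in>star b. of_bool (up s = f) + of_bool (dn s = f) :: real)"
      by (simp add: sum_bends sum.distrib)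
    also have "\<dots> = (\<Sum>b\<in>B. 2 * (of_bool (p b = f) + of_bool (q b = f)))"
      using sides card_star_bend by (intro sum.cong refl) simp
    finally show ?thesis by (simp add: x y sum.distrib sum_distrib_left)
  qed
  \<comment> \<open>The angle of the face at the true vertices: from the total
    \<open>2 * pi * (x f + y f - D f)\<close> the share
    \<open>\<alpha> * x f + (2 * pi - \<alpha>) * y f\<close> of the bends is subtracted.\<close>
  have rest: "(\<Sum>v\<in>{..<N} - B. angle_sum f v) =
      (2 * pi - \<alpha>) * x f + \<alpha> * y f - 2 * pi * D f" for f
  proof -
    have "(\<Sum>v<N. angle_sum f v) = (\<Sum>v\<in>{..<N} - B. angle_sum f v) + (\<Sum>b\<in>B. angle_sum f b)"
      using B_less by (intro sum.subset_diff) auto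
    moreover have "(\<Sum>b\<in>B. angle_sum f b) = \<alpha> * x f + (2 * pi - \<alpha>) * y f"
      by (simp add: pq(1) x y sum.distrib sum_distrib_left)
    moreover define u d t where "u = (\<Sum>s\<in>S. of_bool (up s = f) :: real)"
      and "d = (\<Sum>s\<in>S. of_bool (dn s = f) :: real)" and "t = (\<Sum>v<N. of_bool (over v = f) :: real)"
    then have "(\<Sum>v<N. angle_sum f v) = pi * (d - u) + 2 * pi * t"
      and "u + d = 2 * (real (x f) + real (y f))" and "D f = u - t"
      using total_angle[of f] updn[of f] D[of f] by (simp_all only:)
    moreover from this have "d = 2 * (real (x f) + real (y f)) - u" and "t = u - D f" by linarith+
    ultimately have "(\<Sum>v\<in>{..<N} - B. angle_sum f v) + (\<alpha> * x f + (2 * pi - \<alpha>) * y f) =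
        pi * (2 * (real (x f) + real (y f)) - u - u) + 2 * pi * (u - D f)"
      by metis
    then show ?thesis by (simp add: algebra_simps)
  qed
  have nonneg: "(\<Sum>v\<in>{..<N} - B. angle_sum f v) \<ge> 0" for f
    by (intro sum_nonneg angle_sum_nonneg)
  \<comment> \<open>A segment at a bend bordering \<open>f\<close> has its other end at a true
    vertex, where \<open>f\<close> then has a corner of positive angle.\<close>
  have pos: "(\<Sum>v\<in>{..<N} - B. angle_sum f v) > 0" if "x f + y f > 0" for f
  proof -
    have "{b \<in> B. p b = f} \<noteq> {} \<or> {b \<in> B. q b = f} \<noteq> {}"
      using that by (auto simp: x_def y_def card_gt_0_iff)
    then obtain b where b: "b \<in> B" "f \<in> {p b, q b}" by auto
    obtain s where s: "s \<in> star b" using card_star_bend[OF b(1)] by fastforce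
    then have "s \<in> S" by (auto simp: star_def)
    then have "lft s < N" "rgt s < N" using S_less[of s] by auto
    then obtain v where v: "v \<notin> B" "v < N" "s \<in> star v"
      using one_bend[of s] \<open>s \<in> S\<close> by (auto simp: star_def)
    have "f \<in> {up s, dn s}" using pq(2)[OF b(1) s] b(2) by simp
    then have "cw v s = f \<or> ccw v s = f" by (auto simp: cw_def ccw_def)
    then have "angle_sum f v > 0" using angle_sum_pos v by blast
    then show ?thesis using v angle_sum_nonneg by (intro sum_pos2[of _ v]) auto
  qed
  have D_le: "D f \<le> 1" for f
    using face_count[of f] by (simp add: D_def up_def over_def)
  have face: "4 * D f \<le> 2 * int (x f) + int (y f)" for f
    using \<alpha>_pos \<alpha>_le D_le nonneg[of f] pos[of f] unfolding rest by (rule face_inequality)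
  define outer where "outer = F None"
  have D_outer: "D outer \<le> -1"
    using outer_count by (simp add: D_def up_def over_def outer_def)
  have two_sides: "2 \<le> x outer + y outer" if "b \<in> B" "c \<in> B" "b \<noteq> c" "outer \<in> {p b, q b}" "outer \<in> {p c, q c}" for b c
  proof -
    have "(2::real) \<le> (\<Sum>e\<in>{b, c}. of_bool (p e = outer) + of_bool (q e = outer))" using that by auto
    also have "\<dots> \<le> (\<Sum>e\<in>B. of_bool (p e = outer) + of_bool (q e = outer))"
      using that finite_B by (intro sum_mono2) auto
    also have "\<dots> = real (x outer + y outer)" by (simp add: x y sum.distrib)
    finally show ?thesis by simp
  qed
  \<comment> \<open>At a true vertex the first and the last half-edge border the corner above it. If
    they coincide, both sides of that segment are outer, and so is the convex side of its bend;
    otherwise they lead to two different bends on the outer face.\<close>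
  have outer_vertex: "v \<in> B \<or> 2 \<le> 2 * x outer + y outer" if v: "star v \<noteq> {}" "over v = outer" for v
  proof (cases "v \<in> B")
    case False
    have fin: "finite (dir v ` star v)" "dir v ` star v \<noteq> {}" using finite_star v by auto
    obtain s where s: "s \<in> star v" "dir v s = Min (dir v ` star v)" using Min_in[OF fin] by auto
    obtain t where t: "t \<in> star v" "dir v t = Max (dir v ` star v)" using Max_in[OF fin] by auto
    have "cw v s = outer" using cw_first[of s v] s fin v(2) by auto
    have "ccw v t = outer" using ccw_last[of t v] t fin v(2) by auto
    have S: "s \<in> S" "t \<in> S" using s t by (auto simp: star_def)
    obtain b where b: "b \<in> B" "s \<in> star b" using bend_end S by blast
    obtain c where c: "c \<in> B" "t \<in> star c" using bend_end S by blast
    show ?thesis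
    proof (cases "s = t")
      case True
      then have "up s = outer" "dn s = outer"
        using \<open>cw v s = outer\<close> \<open>ccw v t = outer\<close> by (auto simp: cw_def ccw_def split: if_splits)
      then have "p b = outer" using pq(2)[OF b] by (auto simp: doubleton_eq_iff)
      then have "x outer > 0" using b finite_B by (auto simp: x_def card_gt_0_iff)
      then show ?thesis by simp
    next
      case False
      have "b \<noteq> c"
      proof
        assume "b = c"
        then have "lft s = lft t" "rgt s = rgt t"
          using b c s t S_less[OF S(1)] S_less[OF S(2)] \<open>v \<notin> B\<close> by (auto simp: star_def)
        then show False using same_ends_eq S False by blast
      qed
      moreover have "outer \<in> {up s, dn s}" "outer \<in> {up t, dn t}"
        using \<open>cw v s = outer\<close> \<open>ccw v t = outer\<close> by (auto simp: cw_def ccw_def split: if_splits)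
      ultimately show ?thesis using two_sides[of b c] b c pq(2)[OF b] pq(2)[OF c] by simp
    qed
  qed simp
  \<comment> \<open>The outer face lies above the leftmost and above the rightmost segment end. If
    one of these is a true vertex, \<open>outer_vertex\<close> applies; otherwise they are two
    distinct bends.\<close>
  have xy_outer: "2 \<le> 2 * x outer + y outer"
  proof (rule ccontr)
    assume neg: "\<not> ?thesis"
    have ne: "S \<noteq> {}" using B_nonempty card_S finite_B by auto
    define v w where "v = Min (lft ` S)" and "w = Max (rgt ` S)"
    have "v \<in> lft ` S" unfolding v_def using ne finite_S by (intro Min_in) auto
    then obtain s where s: "s \<in> S" "lft s = v" by auto
    have "w \<in> rgt ` S" unfolding w_def using ne finite_S by (intro Max_in) auto
    then obtain t where t: "t \<in> S" "rgt t = w" by auto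
    have le: "v \<le> lft u" "rgt u \<le> w" if "u \<in> S" for u
      using that finite_S by (auto simp: v_def w_def)
    have "active v = {}" "active (Suc w) = {}" using le by (force simp: active_def)+
    then have "bl v = None" "br w = None" by (simp_all add: bl_def br_def)
    moreover have "w < N" using t S_less by auto
    ultimately have ov: "over v = outer" "over w = outer" using F_step[of w] by (simp_all add: over_def outer_def)
    have "star v \<noteq> {}" "star w \<noteq> {}" using s t by (auto simp: star_def)
    then have vw: "v \<in> B" "w \<in> B" using outer_vertex ov neg by blast+
    have "v < w" using s S_less[of s] le(2)[of s] by auto
    then show False using two_sides[of v w] vw pq(3)[of v] pq(3)[of w] ov neg by auto
  qed
  define L where "L = insert outer (up ` S \<union> over ` {..<N} \<union> p ` B \<union> q ` B)"
  have L: "finite L" using finite_S finite_B by (simp add: L_def)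
  have "real_of_int (\<Sum>f\<in>L. 2 * int (x f) + int (y f) - 4 * D f) =
      2 * (\<Sum>f\<in>L. \<Sum>b\<in>B. of_bool (p b = f)) + (\<Sum>f\<in>L. \<Sum>b\<in>B. of_bool (q b = f)) -
      4 * ((\<Sum>f\<in>L. \<Sum>s\<in>S. of_bool (up s = f)) - (\<Sum>f\<in>L. \<Sum>v<N. of_bool (over v = f)))"
    by (simp add: x y D sum.distrib sum_subtractf sum_distrib_left)
  also have "\<dots> = 2 * real (card B) + real (card B) - 4 * (real (card S) - real N)"
    by (subst (1 2 3 4) sum_of_bool_values[OF L]) (auto simp: L_def)
  finally have total: "real_of_int (\<Sum>f\<in>L. 2 * int (x f) + int (y f) - 4 * D f) =
      4 * real N - 5 * real (card B)" by (simp add: card_S)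
  \<comment> \<open>\<open>D_outer\<close> contributes 4 and \<open>xy_outer\<close> contributes
    2.\<close>
  have "6 \<le> 2 * int (x outer) + int (y outer) - 4 * D outer" using D_outer xy_outer by linarith
  also have "\<dots> \<le> (\<Sum>f\<in>L. 2 * int (x f) + int (y f) - 4 * D f)"
    using L face by (intro member_le_sum) (auto simp: L_def)
  finally have "real_of_int 6 \<le> 4 * real N - 5 * real (card B)" unfolding total[symmetric] of_int_le_iff .
  then show ?thesis by linarith
qed

end

context sweep
begin

lemma bend_bound:
  assumes "0 < \<alpha>" "\<alpha> \<le> 2 * pi / 3" "B \<subseteq> {..<N}" "B \<noteq> {}"
    and "\<And>b. b \<in> B \<Longrightarrow> card (star b) = 2"
    and "\<And>s. s \<in> S \<Longrightarrow> (lft s \<in> B) \<noteq> (rgt s \<in> B)"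
    and "\<And>b s t. b \<in> B \<Longrightarrow> s \<in> star b \<Longrightarrow> t \<in> star b \<Longrightarrow> s \<noteq> t \<Longrightarrow>
      cos (dir b s - dir b t) = cos \<alpha>"
  shows "5 * card B + 6 \<le> 4 * N"
proof -
  have "0 < N" using assms(3,4) by auto
  then obtain F :: "'s option \<Rightarrow> 's option" where F: "\<forall>v<N. F (bl v) = F (br v)"
    "\<forall>f. card {s \<in> S. F (Some s) = f} \<le> card {v. v < N \<and> F (bl v) = f} + 1"
    "card {s \<in> S. F (Some s) = F None} + 1 \<le> card {v. v < N \<and> F (bl v) = F None}"
    using exists_labelling by blast
  interpret bend_sweep N X Y S lft rgt F B \<alpha>
    by unfold_locales (use assms F in auto)
  show ?thesis by (rule edge_bound)
qed

end

subsection \<open>From bend edges to the sweep\<close>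

text \<open>Together with \<open>shear_y\<close> this is the clockwise rotation by
  \<open>arctan t\<close>, scaled by \<open>sqrt (1 + t ^ 2)\<close>; angles are preserved.\<close>

definition shear_x :: "real \<Rightarrow> point \<Rightarrow> real" where "shear_x t p = p $ 1 + t * p $ 2"
definition shear_y :: "real \<Rightarrow> point \<Rightarrow> real" where "shear_y t p = p $ 2 - t * p $ 1"

lemma sweep_direction:
  fixes V :: "point set"
  assumes "finite V"
  shows "\<exists>t. inj_on (shear_x t) V"
proof -
  \<comment> \<open>Each pair of distinct points excludes at most one \<open>t\<close>. Pairs of
    equal ordinate contribute the quotient by zero, a harmless extra value, because for them equal
    images force equal points.\<close>
  let ?bad = "(\<lambda>(p, q). - (p $ 1 - q $ 1) / (p $ 2 - q $ 2)) ` (V \<times> V)"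
  have "finite ?bad" using assms by simp
  then obtain t where t: "t \<notin> ?bad" using ex_new_if_finite infinite_UNIV_char_0 by blast
  have "p $ 1 + t * p $ 2 \<noteq> q $ 1 + t * q $ 2" if "p \<in> V" "q \<in> V" "p \<noteq> q" for p q
  proof
    assume eq: "p $ 1 + t * p $ 2 = q $ 1 + t * q $ 2"
    then have e: "t * (p $ 2 - q $ 2) = - (p $ 1 - q $ 1)" by (simp add: algebra_simps)
    have "p $ 2 \<noteq> q $ 2" using e that(3) by (auto simp: vec_eq_iff forall_2)
    then have "t = - (p $ 1 - q $ 1) / (p $ 2 - q $ 2)" using e by (simp add: field_simps)
    then show False using t that by force
  qed
  then show ?thesis by (auto simp: inj_on_def shear_x_def)
qed

lemma on_segment_collinear:
  fixes p q b :: "'a :: real_vector"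
  assumes "q \<in> closed_segment p b" "q \<noteq> p"
  shows "b \<in> affine hull {p, q}"
proof -
  obtain l where l: "q = (1 - l) *\<^sub>R p + l *\<^sub>R b" using assms(1) by (auto simp: in_segment)
  then have "l \<noteq> 0" using assms(2) by auto
  have "b = (1 - 1 / l) *\<^sub>R p + (1 / l) *\<^sub>R q"
    using \<open>l \<noteq> 0\<close> by (simp add: l algebra_simps)
  moreover have "(1 - 1 / l) + 1 / l = 1" by simp
  ultimately show ?thesis unfolding affine_hull_2 by blast
qed

text \<open>With \<open>z\<close> measured from \<open>b\<close> on both segments, equal parameters
  must vanish because \<open>p \<noteq> q\<close>, while different parameters would make
  \<open>b\<close> an affine combination of \<open>p\<close> and \<open>q\<close>.\<close>

lemma segments_meet_at_bend:
  fixes p q b :: "'a :: real_vector"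
  assumes "z \<in> closed_segment p b" "z \<in> closed_segment q b" "p \<noteq> q" "b \<notin> affine hull {p, q}"
  shows "z = b"
proof -
  obtain l where l: "z = (1 - l) *\<^sub>R b + l *\<^sub>R p"
    using assms(1) by (auto simp: in_segment closed_segment_commute[of p])
  obtain m where m: "z = (1 - m) *\<^sub>R b + m *\<^sub>R q"
    using assms(2) by (auto simp: in_segment closed_segment_commute[of q])
  have eq: "(l - m) *\<^sub>R b = l *\<^sub>R p - m *\<^sub>R q" using l m by (simp add: algebra_simps)
  show ?thesis
  proof (cases "l = m")
    case True
    then have "l *\<^sub>R p = l *\<^sub>R q" using eq by simp
    then show ?thesis using assms(3) l by simp
  next
    case False
    define k where "k = 1 / (l - m)"
    have k: "k * (l - m) = 1" using False by (simp add: k_def)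
    have "b = k *\<^sub>R ((l - m) *\<^sub>R b)" using k by simp
    also have "\<dots> = (k * l) *\<^sub>R p + (- (k * m)) *\<^sub>R q" unfolding eq by (simp add: algebra_simps)
    finally have "b = (k * l) *\<^sub>R p + (- (k * m)) *\<^sub>R q" .
    moreover have "k * l + - (k * m) = 1" using k by (simp add: algebra_simps)
    ultimately have "b \<in> affine hull {p, q}" unfolding affine_hull_2 by blast
    then show ?thesis using assms(4) by simp
  qed
qed

text \<open>\<open>\<delta>\<close> is the polar angle of \<open>(x, y)\<close> on the branch used
  by \<open>dir\<close>.\<close>

lemma cos_sin_arctan_quotient:
  fixes x y :: real
  assumes "x \<noteq> 0"
  defines "\<delta> \<equiv> (if 0 < x then arctan (y / x) else arctan (y / x) - pi)"
  shows "cos \<delta> = x / sqrt (x\<^sup>2 + y\<^sup>2)" and "sin \<delta> = y / sqrt (x\<^sup>2 + y\<^sup>2)"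
proof -
  have "1 + (y / x)\<^sup>2 = (x\<^sup>2 + y\<^sup>2) / x\<^sup>2" using assms by (simp add: field_simps)
  then have s: "sqrt (1 + (y / x)\<^sup>2) = sqrt (x\<^sup>2 + y\<^sup>2) / \<bar>x\<bar>" by (simp add: real_sqrt_divide)
  have pos: "sqrt (x\<^sup>2 + y\<^sup>2) > 0" using assms by (simp add: sum_power2_gt_zero_iff)
  have c: "cos (arctan (y / x)) = \<bar>x\<bar> / sqrt (x\<^sup>2 + y\<^sup>2)" unfolding cos_arctan s using pos by simp
  have n: "sin (arctan (y / x)) = y / x * \<bar>x\<bar> / sqrt (x\<^sup>2 + y\<^sup>2)" unfolding sin_arctan s using pos by simp
  show "cos \<delta> = x / sqrt (x\<^sup>2 + y\<^sup>2)" using assms c by (auto simp: cos_diff)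
  show "sin \<delta> = y / sqrt (x\<^sup>2 + y\<^sup>2)" using assms n by (auto simp: sin_diff)
qed

section \<open>Straight pieces of bend edges\<close>

locale bend_drawing =
  fixes \<alpha> :: real and P :: "point set" and E :: "bend_edge set"
  assumes finite_P: "finite P" and finite_E: "finite E"
    and bend_edge: "e \<in> E \<Longrightarrow> alpha_bend_edge \<alpha> e"
    and ends_in: "e \<in> E \<Longrightarrow> endpoints e \<subseteq> P"
    and vertex_on_edge: "e \<in> E \<Longrightarrow> p \<in> P \<Longrightarrow> p \<in> polyline e \<Longrightarrow> p \<in> endpoints e"
    and edges_meet: "e \<in> E \<Longrightarrow> e' \<in> E \<Longrightarrow> e \<noteq> e' \<Longrightarrow>
      polyline e \<inter> polyline e' \<subseteq> endpoints e \<inter> endpoints e'"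
begin

definition bend :: "bend_edge \<Rightarrow> point" where "bend e = fst (snd e)"

text \<open>The true vertex always comes first and the bend second.\<close>

definition segs :: "(point \<times> point) set" where
  "segs = (\<Union>e\<in>E. (\<lambda>p. (p, bend e)) ` endpoints e)"

lemma seg_polyline: "p \<in> endpoints e \<Longrightarrow> closed_segment p (bend e) \<subseteq> polyline e"
  by (cases e) (auto simp: endpoints_def polyline_def bend_def closed_segment_commute)

lemma bend_in_polyline: "bend e \<in> polyline e"
  by (cases e) (simp add: polyline_def bend_def)

text \<open>The case \<open>p = q\<close> is included and says that the bend is not an
  endpoint.\<close>

lemma bend_not_collinear:
  assumes "e \<in> E" "p \<in> endpoints e" "q \<in> endpoints e"
  shows "bend e \<notin> affine hull {p, q}"
proof -
  obtain a b c where e: "e = (a, b, c)" by (cases e)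
  have "b \<notin> affine hull {a, c}" using bend_edge[OF assms(1)] by (simp add: e alpha_bend_edge_def)
  moreover have "affine hull {p, q} \<subseteq> affine hull {a, c}"
    using assms by (intro hull_mono) (auto simp: e endpoints_def)
  ultimately show ?thesis by (auto simp: e bend_def)
qed

lemma bend_notin_P: "e \<in> E \<Longrightarrow> bend e \<notin> P"
  using vertex_on_edge[of e "bend e"] bend_in_polyline[of e] bend_not_collinear[of e "bend e" "bend e"]
  by auto

lemma bend_on_edge:
  assumes "e \<in> E" "e' \<in> E" "bend e' \<in> polyline e"
  shows "e' = e"
proof (rule ccontr)
  assume "e' \<noteq> e"
  then have "bend e' \<in> endpoints e'" using edges_meet[of e e'] assms bend_in_polyline by blast
  then show False using bend_notin_P ends_in assms by blast
qed

lemma bend_inj: "inj_on bend E"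
  using bend_on_edge bend_in_polyline by (metis inj_onI)

lemma end_on_segment:
  assumes "e \<in> E" "p \<in> endpoints e" "q \<in> endpoints e" "q \<in> closed_segment p (bend e)"
  shows "q = p"
  using on_segment_collinear[OF assms(4)] bend_not_collinear[OF assms(1-3)] by blast

lemma segsE:
  assumes "s \<in> segs"
  obtains e p where "e \<in> E" "p \<in> endpoints e" "s = (p, bend e)" "p \<in> P" "bend e \<notin> P"
  using assms ends_in bend_notin_P by (fastforce simp: segs_def)

definition pts :: "point set" where "pts = P \<union> bend ` E"

lemma point_on_segment:
  assumes "(p, b) \<in> segs" "z \<in> pts" "z \<in> closed_segment p b"
  shows "z = p \<or> z = b"
proof -
  obtain e where e: "e \<in> E" "p \<in> endpoints e" "b = bend e" using assms(1) by (auto elim: segsE)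
  then have z: "z \<in> polyline e" using seg_polyline assms(3) by blast
  show ?thesis
  proof (cases "z \<in> P")
    case True
    then show ?thesis using vertex_on_edge e z end_on_segment assms(3) by blast
  next
    case False
    then obtain e' where "e' \<in> E" "z = bend e'" using assms(2) by (auto simp: pts_def)
    then show ?thesis using bend_on_edge[OF e(1)] z e(3) by blast
  qed
qed

text \<open>Supplies \<open>meet\<close>. Pieces of one edge share only its bend, and pieces of
  different edges share only common endpoints of these edges.\<close>

lemma segments_meet:
  assumes "(p, b) \<in> segs" "(q, c) \<in> segs" "(p, b) \<noteq> (q, c)"
    and "z \<in> closed_segment p b" "z \<in> closed_segment q c"
  shows "z = p \<or> z = b"
proof -
  obtain e where e: "e \<in> E" "p \<in> endpoints e" "b = bend e" using assms(1) by (auto elim: segsE)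
  obtain e' where e': "e' \<in> E" "q \<in> endpoints e'" "c = bend e'" using assms(2) by (auto elim: segsE)
  show ?thesis
  proof (cases "e = e'")
    case True
    then show ?thesis
      using segments_meet_at_bend[of z p b q] bend_not_collinear[of e p q] e e' assms by blast
  next
    case False
    have "z \<in> polyline e \<inter> polyline e'" using seg_polyline e e' assms(4,5) by blast
    then have "z \<in> endpoints e" using edges_meet[OF e(1) e'(1) False] by blast
    then show ?thesis using end_on_segment e assms(4) by blast
  qed
qed

lemma segs_at_bend:
  assumes "e \<in> E"
  shows "{s \<in> segs. snd s = bend e} = (\<lambda>p. (p, bend e)) ` endpoints e"
  using assms bend_inj by (force simp: segs_def inj_on_def)

lemma finite_segs: "finite segs"
  using finite_E by (auto simp: segs_def endpoints_def split: prod.split)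

lemma finite_pts: "finite pts"
  using finite_P finite_E by (simp add: pts_def)

end

section \<open>The rotated drawing as an instance of the sweep\<close>

locale swept_drawing = bend_drawing +
  fixes t :: real and pt :: "nat \<Rightarrow> point" and idx :: "point \<Rightarrow> nat"
  assumes pt_less: "i < j \<Longrightarrow> j < card pts \<Longrightarrow> shear_x t (pt i) < shear_x t (pt j)"
    and pt_in: "i < card pts \<Longrightarrow> pt i \<in> pts"
    and idx: "p \<in> pts \<Longrightarrow> idx p < card pts \<and> pt (idx p) = p"
begin

abbreviation "u \<equiv> shear_x t"
abbreviation "w \<equiv> shear_y t"

definition lft :: "point \<times> point \<Rightarrow> nat" where "lft s = min (idx (fst s)) (idx (snd s))"
definition rgt :: "point \<times> point \<Rightarrow> nat" where "rgt s = max (idx (fst s)) (idx (snd s))"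
definition X :: "nat \<Rightarrow> real" where "X i = u (pt i)"
definition Y :: "nat \<Rightarrow> real" where "Y i = w (pt i)"

lemma seg_pts: "(p, b) \<in> segs \<Longrightarrow> p \<in> pts \<and> b \<in> pts \<and> p \<in> P \<and> b \<notin> P"
  by (auto elim!: segsE simp: pts_def)

lemma idx_eq: "p \<in> pts \<Longrightarrow> q \<in> pts \<Longrightarrow> idx p = idx q \<longleftrightarrow> p = q"
  using idx by metis

lemma pt_inj: "i < card pts \<Longrightarrow> j < card pts \<Longrightarrow> u (pt i) = u (pt j) \<Longrightarrow> i = j"
  using pt_less[of i j] pt_less[of j i] by (cases i j rule: linorder_cases) auto

lemma idx_pt: "i < card pts \<Longrightarrow> idx (pt i) = i"
  using idx[OF pt_in] pt_inj by metis

lemma seg_ends: "(p, b) \<in> segs \<Longrightarrow> lft (p, b) < rgt (p, b) \<and> rgt (p, b) < card pts"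
  using seg_pts[of p b] idx[of p] idx[of b] idx_eq[of p b] by (auto simp: lft_def rgt_def)

text \<open>The rotation is undone explicitly, up to the nonzero factor
  \<open>1 + t ^ 2\<close>.\<close>

lemma coords_inj:
  assumes "u y = u z" "w y = w z" shows "y = z"
proof -
  have "(1 + t\<^sup>2) * y $ 1 = u y - t * w y" "(1 + t\<^sup>2) * y $ 2 = w y + t * u y"
    "(1 + t\<^sup>2) * z $ 1 = u z - t * w z" "(1 + t\<^sup>2) * z $ 2 = w z + t * u z"
    by (simp_all add: shear_x_def shear_y_def algebra_simps power2_eq_square)
  then have "(1 + t\<^sup>2) * y $ 1 = (1 + t\<^sup>2) * z $ 1" "(1 + t\<^sup>2) * y $ 2 = (1 + t\<^sup>2) * z $ 2"
    using assms by simp_all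
  moreover have "1 + t\<^sup>2 \<noteq> 0" using zero_le_power2[of t] by linarith
  ultimately show ?thesis by (simp add: vec_eq_iff forall_2)
qed

text \<open>Turns an abscissa within the span of a segment back into a point of the plane, so that
  equal heights become common points.\<close>

lemma height_point:
  assumes "(p, b) \<in> segs" "X (lft (p, b)) \<le> x" "x \<le> X (rgt (p, b))"
  shows "\<exists>z\<in>closed_segment p b. u z = x \<and> w z = height X Y (lft (p, b)) (rgt (p, b)) x"
proof -
  define i j where "i = lft (p, b)" and "j = rgt (p, b)"
  have "i < j" "j < card pts" using seg_ends[OF assms(1)] by (auto simp: i_def j_def)
  then have less: "X i < X j" using pt_less by (simp add: X_def)
  have seg: "closed_segment (pt i) (pt j) = closed_segment p b"
    using seg_pts[OF assms(1)] idx[of p] idx[of b]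
    by (auto simp: i_def j_def lft_def rgt_def min_def max_def closed_segment_commute)
  define l where "l = (x - X i) / (X j - X i)"
  have l: "0 \<le> l" "l \<le> 1" "l * (X j - X i) = x - X i"
    using less assms by (auto simp: l_def i_def j_def)
  define z where "z = (1 - l) *\<^sub>R pt i + l *\<^sub>R pt j"
  have "z \<in> closed_segment p b" using l unfolding seg[symmetric] z_def in_segment by blast
  moreover have "u z = X i + l * (X j - X i)"
    by (simp add: z_def shear_x_def X_def algebra_simps)
  moreover have "w z = Y i + l * (Y j - Y i)"
    by (simp add: z_def shear_y_def Y_def algebra_simps)
  moreover have "l * (Y j - Y i) = slope X Y i j * (x - X i)"
    by (simp add: l_def slope_def)
  ultimately show ?thesis using l by (auto simp: height_def i_def j_def)
qed

lemma X_idx: "p \<in> pts \<Longrightarrow> X (idx p) = u p" and Y_idx: "p \<in> pts \<Longrightarrow> Y (idx p) = w p"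
  using idx by (auto simp: X_def Y_def)

sublocale sweep "card pts" X Y segs lft rgt
proof
  show "X i < X j" if "i < j" "j < card pts" for i j using pt_less that by (simp add: X_def)
  show "finite segs" by (rule finite_segs)
  show "lft s < rgt s \<and> rgt s < card pts" if "s \<in> segs" for s
    using seg_ends[of "fst s" "snd s"] that by simp
next
  fix s s' x
  assume s: "s \<in> segs" "s' \<in> segs" "s \<noteq> s'" and x: "X (lft s) \<le> x" "x \<le> X (rgt s)"
    "X (lft s') \<le> x" "x \<le> X (rgt s')"
    and eq: "height X Y (lft s) (rgt s) x = height X Y (lft s') (rgt s') x"
  obtain p b q c where pq: "s = (p, b)" "s' = (q, c)" by (cases s, cases s')
  obtain z where z: "z \<in> closed_segment p b" "u z = x" "w z = height X Y (lft s) (rgt s) x"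
    using height_point[of p b x] s x pq by auto
  obtain z' where z': "z' \<in> closed_segment q c" "u z' = x" "w z' = height X Y (lft s') (rgt s') x"
    using height_point[of q c x] s x pq by auto
  have "z = z'" using coords_inj z z' eq by simp
  then have "z = p \<or> z = b" using segments_meet[of p b q c z] s pq z z' by simp
  then have "x = X (idx p) \<or> x = X (idx b)" using z(2) seg_pts[of p b] s pq X_idx by auto
  then show "x = X (lft s) \<or> x = X (rgt s)" by (auto simp: pq lft_def rgt_def min_def max_def)
next
  fix s v
  assume s: "s \<in> segs" and v: "lft s < v" "v < rgt s"
  obtain p b where pb: "s = (p, b)" by (cases s)
  have N: "v < card pts" "rgt s < card pts" using seg_ends[of p b] s v pb by auto
  show "height X Y (lft s) (rgt s) (X v) \<noteq> Y v"
  proof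
    assume eq: "height X Y (lft s) (rgt s) (X v) = Y v"
    have "X (lft s) \<le> X v" "X v \<le> X (rgt s)" using pt_less v N by (auto simp: X_def intro!: less_imp_le)
    then obtain z where z: "z \<in> closed_segment p b" "u z = X v" "w z = Y v"
      using height_point[of p b "X v"] s pb eq by auto
    then have "z = pt v" using coords_inj by (simp add: X_def Y_def)
    then have "pt v = p \<or> pt v = b" using point_on_segment[of p b "pt v"] pt_in N z s pb by simp
    then have "v = idx p \<or> v = idx b" using idx_pt[OF N(1)] by auto
    then show False using v by (auto simp: pb lft_def rgt_def)
  qed
qed

lemma star_bend:
  assumes "e \<in> E"
  shows "star (idx (bend e)) = (\<lambda>p. (p, bend e)) ` endpoints e"
proof -
  have b: "bend e \<in> pts" "bend e \<notin> P" using assms bend_notin_P by (auto simp: pts_def)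
  have "(lft s = idx (bend e) \<or> rgt s = idx (bend e)) \<longleftrightarrow> snd s = bend e" if "s \<in> segs" for s
  proof -
    have "fst s \<in> pts" "snd s \<in> pts" "fst s \<noteq> bend e"
      using seg_pts[of "fst s" "snd s"] that b by auto
    then have "idx (fst s) \<noteq> idx (bend e)" "idx (snd s) = idx (bend e) \<longleftrightarrow> snd s = bend e"
      using idx_eq b by auto
    then show ?thesis by (auto simp: lft_def rgt_def min_def max_def)
  qed
  then show ?thesis unfolding segs_at_bend[OF assms, symmetric] star_def by blast
qed

lemma slope_seg:
  assumes "(p, b) \<in> segs"
  shows "slope X Y (lft (p, b)) (rgt (p, b)) = (w p - w b) / (u p - u b)"
proof -
  have "(w p - w b) / (u p - u b) = (w b - w p) / (u b - u p)"
    by (metis minus_diff_eq minus_divide_left minus_divide_right minus_minus)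
  then show ?thesis
    using seg_pts[OF assms] by (auto simp: slope_def lft_def rgt_def min_def max_def X_idx Y_idx)
qed

text \<open>At its bend end a piece has as \<open>dir\<close> the polar angle of
  \<open>p - b\<close> in rotated coordinates.\<close>

lemma dir_bend:
  assumes "(p, b) \<in> segs"
  shows "cos (dir (idx b) (p, b)) = (u p - u b) / sqrt ((u p - u b)\<^sup>2 + (w p - w b)\<^sup>2)"
    and "sin (dir (idx b) (p, b)) = (w p - w b) / sqrt ((u p - u b)\<^sup>2 + (w p - w b)\<^sup>2)"
proof -
  have pb: "p \<in> pts" "b \<in> pts" "p \<noteq> b" using seg_pts[OF assms] by auto
  then have ne: "idx p \<noteq> idx b" using idx_eq by auto
  have "u p \<noteq> u b" using pt_inj[of "idx p" "idx b"] idx[of p] idx[of b] pb ne by auto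
  have "lft (p, b) = idx b \<longleftrightarrow> u b < u p"
    using pt_less[of "idx p" "idx b"] pt_less[of "idx b" "idx p"] idx[of p] idx[of b] pb ne
    by (cases "idx p < idx b") (auto simp: lft_def)
  then have "dir (idx b) (p, b) = (if 0 < u p - u b then arctan ((w p - w b) / (u p - u b))
      else arctan ((w p - w b) / (u p - u b)) - pi)"
    by (simp add: dir_def slope_seg[OF assms])
  then show "cos (dir (idx b) (p, b)) = (u p - u b) / sqrt ((u p - u b)\<^sup>2 + (w p - w b)\<^sup>2)"
    and "sin (dir (idx b) (p, b)) = (w p - w b) / sqrt ((u p - u b)\<^sup>2 + (w p - w b)\<^sup>2)"
    using cos_sin_arctan_quotient[of "u p - u b" "w p - w b"] \<open>u p \<noteq> u b\<close> by simp_all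
qed

lemma inner_coords:
  "(u p - u b) * (u q - u b) + (w p - w b) * (w q - w b) = (1 + t\<^sup>2) * ((p - b) \<bullet> (q - b))"
  by (simp add: shear_x_def shear_y_def inner_vec_def sum_2 algebra_simps power2_eq_square)

text \<open>The addition formula gives the normalised inner product of the rotated vectors, in which
  the scaling factor cancels.\<close>

lemma cos_dir_diff:
  assumes "(p, b) \<in> segs" "(q, b) \<in> segs"
  shows "cos (dir (idx b) (p, b) - dir (idx b) (q, b)) = cos (vangle p b q)"
proof -
  have n: "sqrt ((u p - u b)\<^sup>2 + (w p - w b)\<^sup>2) = sqrt (1 + t\<^sup>2) * norm (p - b)" for p
    using inner_coords[of p b p] by (simp add: power2_eq_square real_sqrt_mult norm_eq_sqrt_inner)
  have t: "sqrt (1 + t\<^sup>2) * sqrt (1 + t\<^sup>2) = 1 + t\<^sup>2" "1 + t\<^sup>2 \<noteq> 0"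
    using zero_le_power2[of t] by (simp, linarith)
  have "cos (dir (idx b) (p, b) - dir (idx b) (q, b)) =
      ((u p - u b) * (u q - u b) + (w p - w b) * (w q - w b)) /
      ((sqrt (1 + t\<^sup>2) * norm (p - b)) * (sqrt (1 + t\<^sup>2) * norm (q - b)))"
    unfolding cos_diff dir_bend[OF assms(1)] dir_bend[OF assms(2)] n by (simp add: add_divide_distrib)
  also have "\<dots> = ((1 + t\<^sup>2) * ((p - b) \<bullet> (q - b))) / ((1 + t\<^sup>2) * (norm (p - b) * norm (q - b)))"
  proof -
    have "(r * x) * (r * y) = (r * r) * (x * y)" for r x y :: real by (simp add: ac_simps)
    from this[of "sqrt (1 + t\<^sup>2)" "norm (p - b)" "norm (q - b)"]
    show ?thesis unfolding inner_coords t(1) by (rule arg_cong)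
  qed
  also have "\<dots> = ((p - b) \<bullet> (q - b)) / (norm (p - b) * norm (q - b))"
    using t(2) by (rule mult_divide_mult_cancel_left)
  also have "\<dots> = cos (vangle p b q)"
  proof -
    \<comment> \<open>The argument of \<open>arccos\<close> is admissible; a vanishing denominator
      makes the quotient 0.\<close>
    have "\<bar>((p - b) \<bullet> (q - b)) / (norm (p - b) * norm (q - b))\<bar> \<le> 1"
      using Cauchy_Schwarz_ineq2[of "p - b" "q - b"]
      by (cases "norm (p - b) * norm (q - b) = 0") (auto simp: abs_mult divide_le_eq_1)
    then show ?thesis by (simp add: vangle_def cos_arccos_abs)
  qed
  finally show ?thesis .
qed

text \<open>The sweep has \<open>card P + card E\<close> points, so
  \<open>5 * card E + 6 \<le> 4 * (card P + card E)\<close> yields the claim.\<close>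

lemma card_edges_le:
  assumes "0 < \<alpha>" "\<alpha> \<le> 2 * pi / 3" "E \<noteq> {}"
  shows "card E + 6 \<le> 4 * card P"
proof -
  define B where "B = idx ` bend ` E"
  have bend_pts: "bend ` E \<subseteq> pts" by (auto simp: pts_def)
  then have "inj_on idx (bend ` E)" using idx_eq by (meson inj_onI subsetD)
  then have "card B = card E" by (simp add: B_def card_image bend_inj)
  moreover have "card pts = card P + card E"
    unfolding pts_def using finite_P finite_E bend_notin_P bend_inj
    by (subst card_Un_disjoint) (auto simp: card_image)
  moreover have "5 * card B + 6 \<le> 4 * card pts"
  proof (rule bend_bound[OF assms(1,2)])
    show "B \<subseteq> {..<card pts}" "B \<noteq> {}" using idx bend_pts assms(3) by (auto simp: B_def)
  next
    fix v assume "v \<in> B"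
    then obtain e where e: "e \<in> E" "v = idx (bend e)" by (auto simp: B_def)
    obtain a b c where abc: "e = (a, b, c)" by (cases e)
    have ac: "a \<noteq> c" "vangle a b c = \<alpha>"
      using bend_edge[OF e(1)] by (auto simp: abc alpha_bend_edge_def)
    have star: "star v = {(a, b), (c, b)}"
      unfolding e(2) star_bend[OF e(1)] by (auto simp: abc endpoints_def bend_def)
    show "card (star v) = 2" using ac by (simp add: star)
    have segs: "(a, b) \<in> segs" "(c, b) \<in> segs" using star by (auto simp: star_def)
    have "v = idx b" by (simp add: e(2) abc bend_def)
    moreover have "vangle c b a = \<alpha>" using ac(2) by (simp add: vangle_def inner_commute mult.commute)
    ultimately show "cos (dir v s - dir v s') = cos \<alpha>"
      if "s \<in> star v" "s' \<in> star v" "s \<noteq> s'" for s s'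
      using that star cos_dir_diff[OF segs] cos_dir_diff[OF segs(2,1)] ac(2) by auto
  next
    fix s assume "s \<in> segs"
    then obtain e p where s: "e \<in> E" "s = (p, bend e)" "p \<in> P" by (auto elim: segsE)
    have "idx p \<notin> B"
    proof
      assume "idx p \<in> B"
      then obtain e' where "e' \<in> E" "idx p = idx (bend e')" by (auto simp: B_def)
      then show False using idx_eq[of p "bend e'"] s(3) bend_notin_P[of e'] by (auto simp: pts_def)
    qed
    moreover have "idx (bend e) \<in> B" using s by (simp add: B_def)
    ultimately show "(lft s \<in> B) \<noteq> (rgt s \<in> B)"
      by (auto simp: s lft_def rgt_def min_def max_def)
  qed
  ultimately show ?thesis by linarith
qed

end

lemma (in bend_drawing) edge_bound:
  assumes "0 < \<alpha>" "\<alpha> \<le> 2 * pi / 3" "E \<noteq> {}"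
  shows "card E + 6 \<le> 4 * card P"
proof -
  obtain t where t: "inj_on (shear_x t) pts" using sweep_direction[OF finite_pts] by blast
  obtain ps0 where ps0: "set ps0 = pts" "distinct ps0" using finite_distinct_list[OF finite_pts] by blast
  define ps where "ps = sort_key (shear_x t) ps0"
  have ps: "set ps = pts" "distinct ps" using ps0 by (simp_all add: ps_def)
  then have len: "length ps = card pts" using distinct_card by metis
  have "distinct (map (shear_x t) ps)" using ps t by (simp add: distinct_map)
  moreover have "sorted (map (shear_x t) ps)" by (simp add: ps_def)
  ultimately have "sorted_wrt (<) (map (shear_x t) ps)" by (simp add: strict_sorted_iff)
  then have less: "shear_x t (ps ! i) < shear_x t (ps ! j)" if "i < j" "j < card pts" for i j
    using that by (simp add: sorted_wrt_map sorted_wrt_iff_nth_less len)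
  have "\<forall>p\<in>pts. \<exists>i. i < card pts \<and> ps ! i = p" using ps(1) len by (metis in_set_conv_nth)
  then obtain idx where idx: "\<And>p. p \<in> pts \<Longrightarrow> idx p < card pts \<and> ps ! idx p = p" by metis
  interpret swept_drawing \<alpha> P E t "(!) ps" idx
    by unfold_locales (use less idx ps len in auto)
  show ?thesis using assms by (rule card_edges_le)
qed

theorem theorem11:
  fixes \<alpha> :: real and n :: nat and P :: "point set" and es :: "bend_edge list"
  assumes "0 < \<alpha>" and "\<alpha> \<le> 2 * pi / 3"
    and "n \<ge> 2" and "finite P" and "card P = n"
    and "alpha_bend_multigraph \<alpha> P es"
  shows "length es \<le> 4 * n - 6"
proof (cases "es = []")
  case False
  have edge: "alpha_bend_edge \<alpha> e" "endpoints e \<subseteq> P" "\<And>p. p \<in> P \<Longrightarrow> p \<in> polyline e \<Longrightarrow> p \<in> endpoints e"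
    if "e \<in> set es" for e
    using assms(6) that by (auto simp: alpha_bend_multigraph_def)
  have meet: "polyline (es ! i) \<inter> polyline (es ! j) \<subseteq> endpoints (es ! i) \<inter> endpoints (es ! j)"
    if "i < length es" "j < length es" "i \<noteq> j" for i j
    using assms(6) that by (simp add: alpha_bend_multigraph_def)
  interpret bend_drawing \<alpha> P "set es"
  proof
    show "polyline e \<inter> polyline e' \<subseteq> endpoints e \<inter> endpoints e'"
      if "e \<in> set es" "e' \<in> set es" "e \<noteq> e'" for e e'
      using that meet by (metis in_set_conv_nth)
  qed (use assms(4) edge in auto)
  \<comment> \<open>A repeated edge would share its bend with its copy, and the bend would have to
    be an endpoint. Hence passing to \<open>set es\<close> loses no edge.\<close>
  have "distinct es"
    unfolding distinct_conv_nth
  proof (intro allI impI notI)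
    fix i j assume ij: "i < length es" "j < length es" "i \<noteq> j" "es ! i = es ! j"
    have "bend (es ! i) \<in> endpoints (es ! i)" using meet[OF ij(1-3)] ij(4) bend_in_polyline[of "es ! j"] by auto
    then show False using bend_notin_P[of "es ! i"] ends_in[of "es ! i"] ij(1) by auto
  qed
  then have "length es + 6 \<le> 4 * n"
    using edge_bound assms(1,2,5) False by (simp add: distinct_card)
  then show ?thesis by simp
qed simp

end
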